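(* Let $\Phi=(A;\{E_i\}_{i=0}^d;A^*;\{E_i^*\}_{i=0}^d)$ be a tridiagonal system of diameter $d\geq 1$ on $V$ over $\mathbb{K}$, with second split decomposition $\{U_i^{\Downarrow}\}_{i=0}^d$, and let $\Psi\in\mathrm{End}(V)$ be the linear transformation attached to $\Phi$ as defined in the context. Then $$\Psi U_i^{\Downarrow}\subseteq U_{i-1}^{\Downarrow}\quad(1\le i\le d),\qquad \Psi U_0^{\Downarrow}=0.$$
   Context: $\mathbb{K}$ is a field, $V$ is a $\mathbb{K}$-vector space of finite positive dimension, $\mathrm{End}(V)$ is the algebra of linear maps $V\to V$. A tridiagonal pair (TD pair) on $V$ is an ordered pair $A,A^*\in\mathrm{End}(V)$ ($A^*$ is just a name, not an adjoint) such that: (i) $A$ and $A^*$ are each diagonalizable over $\mathbb{K}$; (ii) there is an ordering $\{V_i\}_{i=0}^d$ of the eigenspaces of $A$ with $A^*V_i\subseteq V_{i-1}+V_i+V_{i+1}$ for $0\le i\le d$, where $V_{-1}=V_{d+1}=0$; (iii) there is an ordering $\{V_i^*\}_{i=0}^{\delta}$ of the eigenspaces of $A^*$ with $AV_i^*\subseteq V_{i-1}^*+V_i^*+V_{i+1}^*$ for $0\le i\le\delta$, where $V_{-1}^*=V_{\delta+1}^*=0$; (iv) there is no subspace $W$ of $V$ with $AW\subseteq W$, $A^*W\subseteq W$, $W\ne0$, $W\ne V$. It is known that $d=\delta$; this is the diameter, and it is assumed that $d\ge1$. Orderings satisfying (ii) (resp. (iii)) are called standard. The primitive idempotent of a diagonalizable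 map associated with one of its eigenspaces is the projection of $V$ onto that eigenspace that kills the other eigenspaces. A tridiagonal system (TD system) on $V$ is a sequence $\Phi=(A;\{E_i\}_{i=0}^d;A^*;\{E_i^*\}_{i=0}^d)$ where $A,A^*$ is a TD pair on $V$, $\{E_i\}_{i=0}^d$ is an ordering of the primitive idempotents of $A$ such that $\{E_iV\}_{i=0}^d$ is standard, and $\{E_i^*\}_{i=0}^d$ is an ordering of the primitive idempotents of $A^*$ such that $\{E_i^*V\}_{i=0}^d$ is standard. Let $\theta_i$ be the eigenvalue of $A$ on $E_iV$. For $0\le i\le d$ set $U_i^{\Downarrow}=(E_0^*V+\cdots+E_i^*V)\cap(E_0V+\cdots+E_{d-i}V)$. It is known that $V=\bigoplus_{i=0}^dU_i^{\Downarrow}$ (second split decomposition). For $0\le i\le d/2$ set $K_i=(E_0^*V+\cdots+E_i^*V)\cap(E_iV+E_{i+1}V+\cdots+E_{d-i}V)$. For $0\le i\le j\le d+1$ set $\tau_{ij}=(x-\theta_i)(x-\theta_{i+1})\cdots(x-\theta_{j-1})\in\mathbb{K}[x]$, with $\tau_{ii}=1$ and $\tau_{i,i-1}=0$. For $0\le i\le d+1$ set $\vartheta_i=\sum_{h=0}^{i-1}\frac{\theta_h-\theta_{d-h}}{\theta_0-\theta_d}$. It is known that $V=\bigoplus_{0\le i\le d/2}\bigoplus_{j=i}^{d-i}\tau_{ij}(A)K_i$. $\Psi$ is the unique element of $\mathrm{End}(V)$ such that $\Psi\tau_{ij}(A)v=(\vartheta_j-\vartheta_i)\tau_{i,j-1}(A)v$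 for all $0\le i\le d/2$, $i\le j\le d-i$, $v\in K_i$. *)

theory Defs
  imports
    Complex_Main
    "HOL-Library.Set_Algebras"
    "HOL-Computational_Algebra.Polynomial"
begin

text \<open>
  Sums of subspaces are the elementwise sums of sets from \<^theory>\<open>HOL-Library.Set_Algebras\<close>; in
  particular an empty sum is \<open>{0}\<close>. The vector space \<open>V\<close> is the whole type \<open>'v\<close> with scalar
  multiplication \<open>scl\<close>, and \<open>P V\<close> for a map \<open>P\<close> is \<open>range P\<close>.
\<close>

type_synonym ('k, 'v) scl = "'k \<Rightarrow> 'v \<Rightarrow> 'v"

definition eigenspace :: "('k::field, 'v::ab_group_add) scl \<Rightarrow> ('v \<Rightarrow> 'v) \<Rightarrow> 'k \<Rightarrow> 'v set" where
  "eigenspace scl f t = {v. f v = scl t v}"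

definition eigenspaces :: "('k::field, 'v::ab_group_add) scl \<Rightarrow> ('v \<Rightarrow> 'v) \<Rightarrow> 'v set set" where
  "eigenspaces scl f = {eigenspace scl f t | t. \<exists>v. v \<noteq> 0 \<and> f v = scl t v}"

definition diagonalizable :: "('k::field, 'v::ab_group_add) scl \<Rightarrow> ('v \<Rightarrow> 'v) \<Rightarrow> bool" where
  "diagonalizable scl f \<longleftrightarrow>
     Vector_Spaces.linear scl scl f \<and> module.span scl (\<Union>(eigenspaces scl f)) = UNIV"

text \<open>
  \<open>{V\<^sub>i}\<close>, \<open>0 \<le> i \<le> d\<close>, is a standard ordering of the eigenspaces of \<open>f\<close> with respect to \<open>g\<close>. The
  index set of the sum is \<open>{i-1, i, i+1}\<close> intersected with \<open>{0..d}\<close>, which encodes the convention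
  that \<open>V\<^bsub>-1\<^esub>\<close> and \<open>V\<^bsub>d+1\<^esub>\<close> are zero.
\<close>

definition standard_ordering ::
  "('k::field, 'v::ab_group_add) scl \<Rightarrow> ('v \<Rightarrow> 'v) \<Rightarrow> ('v \<Rightarrow> 'v) \<Rightarrow> nat \<Rightarrow> (nat \<Rightarrow> 'v set) \<Rightarrow> bool"
where
  "standard_ordering scl f g d V \<longleftrightarrow>
     bij_betw V {0..d} (eigenspaces scl f) \<and>
     (\<forall>i\<le>d. g ` V i \<subseteq> (\<Sum>j \<in> {j. j \<le> d \<and> i \<le> j + 1 \<and> j \<le> i + 1}. V j))"

definition TD_pair :: "('k::field, 'v::ab_group_add) scl \<Rightarrow> ('v \<Rightarrow> 'v) \<Rightarrow> ('v \<Rightarrow> 'v) \<Rightarrow> bool" where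
  "TD_pair scl A As \<longleftrightarrow>
     diagonalizable scl A \<and> diagonalizable scl As \<and>
     (\<exists>d V. standard_ordering scl A As d V) \<and>
     (\<exists>\<delta> Vs. standard_ordering scl As A \<delta> Vs) \<and>
     \<not> (\<exists>W. module.subspace scl W \<and> A ` W \<subseteq> W \<and> As ` W \<subseteq> W \<and> W \<noteq> {0} \<and> W \<noteq> UNIV)"

definition is_primitive_idempotent ::
  "('k::field, 'v::ab_group_add) scl \<Rightarrow> ('v \<Rightarrow> 'v) \<Rightarrow> 'v set \<Rightarrow> ('v \<Rightarrow> 'v) \<Rightarrow> bool"
where
  "is_primitive_idempotent scl f W P \<longleftrightarrow>
     Vector_Spaces.linear scl scl P \<and> range P = W \<and> (\<forall>v\<in>W. P v = v) \<and>
     (\<forall>W'\<in>eigenspaces scl f. W' \<noteq> W \<longrightarrow> (\<forall>v\<in>W'. P v = 0))"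

definition primitive_idempotents ::
  "('k::field, 'v::ab_group_add) scl \<Rightarrow> ('v \<Rightarrow> 'v) \<Rightarrow> ('v \<Rightarrow> 'v) set"
where
  "primitive_idempotents scl f = {P. \<exists>W\<in>eigenspaces scl f. is_primitive_idempotent scl f W P}"

text \<open>\<open>As\<close> and \<open>Es\<close> stand for \<open>A\<^sup>*\<close> and \<open>E\<^sup>*\<close>; only the values \<open>E i\<close>, \<open>Es i\<close> with \<open>i \<le> d\<close> matter.\<close>

definition TD_system ::
  "('k::field, 'v::ab_group_add) scl \<Rightarrow> nat \<Rightarrow>
     ('v \<Rightarrow> 'v) \<Rightarrow> (nat \<Rightarrow> 'v \<Rightarrow> 'v) \<Rightarrow> ('v \<Rightarrow> 'v) \<Rightarrow> (nat \<Rightarrow> 'v \<Rightarrow> 'v) \<Rightarrow> bool"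
where
  "TD_system scl d A E As Es \<longleftrightarrow>
     TD_pair scl A As \<and>
     bij_betw E {0..d} (primitive_idempotents scl A) \<and>
     standard_ordering scl A As d (\<lambda>i. range (E i)) \<and>
     bij_betw Es {0..d} (primitive_idempotents scl As) \<and>
     standard_ordering scl As A d (\<lambda>i. range (Es i))"

text \<open>The eigenvalue \<open>\<theta>\<^sub>i\<close> of \<open>A\<close> on \<open>E\<^sub>i V\<close>, which is unique because \<open>E\<^sub>i V\<close> is nonzero.\<close>

definition theta ::
  "('k::field, 'v::ab_group_add) scl \<Rightarrow> ('v \<Rightarrow> 'v) \<Rightarrow> (nat \<Rightarrow> 'v \<Rightarrow> 'v) \<Rightarrow> nat \<Rightarrow> 'k"
where
  "theta scl A E i = (THE t. \<forall>v\<in>range (E i). A v = scl t v)"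

text \<open>The components \<open>U\<^sub>i\<^sup>\<Down>\<close> of the second split decomposition.\<close>

definition U_Down ::
  "nat \<Rightarrow> (nat \<Rightarrow> 'v::ab_group_add \<Rightarrow> 'v) \<Rightarrow> (nat \<Rightarrow> 'v \<Rightarrow> 'v) \<Rightarrow> nat \<Rightarrow> 'v set"
where
  "U_Down d E Es i = (\<Sum>h\<in>{0..i}. range (Es h)) \<inter> (\<Sum>h\<in>{0..d - i}. range (E h))"

definition K_sub ::
  "nat \<Rightarrow> (nat \<Rightarrow> 'v::ab_group_add \<Rightarrow> 'v) \<Rightarrow> (nat \<Rightarrow> 'v \<Rightarrow> 'v) \<Rightarrow> nat \<Rightarrow> 'v set"
where
  "K_sub d E Es i = (\<Sum>h\<in>{0..i}. range (Es h)) \<inter> (\<Sum>h\<in>{i..d - i}. range (E h))"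

definition tau :: "(nat \<Rightarrow> 'k::field) \<Rightarrow> nat \<Rightarrow> nat \<Rightarrow> 'k poly" where
  "tau \<theta> i j = (if j < i then 0 else (\<Prod>h\<in>{i..<j}. [:- \<theta> h, 1:]))"

definition vartheta :: "nat \<Rightarrow> (nat \<Rightarrow> 'k::field) \<Rightarrow> nat \<Rightarrow> 'k" where
  "vartheta d \<theta> i = (\<Sum>h\<in>{0..<i}. (\<theta> h - \<theta> (d - h)) / (\<theta> 0 - \<theta> d))"

definition poly_endo ::
  "('k::field, 'v::ab_group_add) scl \<Rightarrow> 'k poly \<Rightarrow> ('v \<Rightarrow> 'v) \<Rightarrow> 'v \<Rightarrow> 'v"
where
  "poly_endo scl p f v = (\<Sum>k\<le>degree p. scl (coeff p k) ((f ^^ k) v))"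

text \<open>
  The characterization of \<open>\<Psi>\<close>. For \<open>i = j\<close> the right-hand side vanishes because of its scalar
  factor, so the value of \<open>tau \<theta> 0 (0 - 1)\<close> (with truncated subtraction) is irrelevant.
\<close>

definition is_Psi ::
  "('k::field, 'v::ab_group_add) scl \<Rightarrow> nat \<Rightarrow>
     ('v \<Rightarrow> 'v) \<Rightarrow> (nat \<Rightarrow> 'v \<Rightarrow> 'v) \<Rightarrow> (nat \<Rightarrow> 'v \<Rightarrow> 'v) \<Rightarrow> ('v \<Rightarrow> 'v) \<Rightarrow> bool"
where
  "is_Psi scl d A E Es \<Psi> \<longleftrightarrow>
     Vector_Spaces.linear scl scl \<Psi> \<and>
     (let \<theta> = theta scl A E in
      \<forall>i j v. 2 * i \<le> d \<longrightarrow> i \<le> j \<longrightarrow> j \<le> d - i \<longrightarrow> v \<in> K_sub d E Es i \<longrightarrow>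
        \<Psi> (poly_endo scl (tau \<theta> i j) A v) =
          scl (vartheta d \<theta> j - vartheta d \<theta> i) (poly_endo scl (tau \<theta> i (j - 1)) A v))"

end

theory Submission
  imports Defs
begin

text \<open>
  The map \<open>\<Psi>\<close> is given on the vectors \<open>\<tau>\<^sub>j\<^sub>l(A)v\<close> with \<open>v\<close> in \<open>K\<^sub>j\<close>, where the factors \<open>A - \<theta>\<^sub>h\<close> are taken in the
  order \<open>h = j, j + 1, \<dots>\<close>. Those vectors span the components of the first split decomposition, and
  \<open>\<Psi>\<close> visibly lowers them. The second split decomposition is the first one of the system
  with the eigenspaces of \<open>A\<close> in reversed order, and the \<open>K\<^sub>j\<close> do not change under this reversal. So
  \<open>U\<^sub>i\<^sup>\<Down>\<close> is spanned by the vectors \<open>\<eta>\<^sub>j\<^sub>i(A)v\<close>, \<open>v\<close> in \<open>K\<^sub>j\<close>, where \<open>\<eta>\<^sub>j\<^sub>i = (x - \<theta>\<^sub>d\<^sub>-\<^sub>j) \<cdots> (x - \<theta>\<^sub>d\<^sub>-\<^sub>i\<^sub>+\<^sub>1)\<close>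
  (lemma \<open>flag_meet_span\<close> for the reversed system), and the claim follows from
  \<open>\<Psi> \<eta>\<^sub>j\<^sub>i(A)v = (\<vartheta>\<^sub>i - \<vartheta>\<^sub>j) \<eta>\<^sub>j\<^sub>,\<^sub>i\<^sub>-\<^sub>1(A)v\<close>: the formula that defines \<open>\<Psi>\<close> is invariant under reversal.

  This invariance, lemma \<open>newton_lowering_reverse\<close>, is a property of the eigenvalues. They satisfy a
  symmetric quadratic relation between neighbours,
  \<open>\<theta>\<^sub>i\<^sup>2 - \<beta>\<theta>\<^sub>i\<theta>\<^sub>i\<^sub>+\<^sub>1 + \<theta>\<^sub>i\<^sub>+\<^sub>1\<^sup>2 - \<gamma>(\<theta>\<^sub>i + \<theta>\<^sub>i\<^sub>+\<^sub>1) = \<rho>\<close>, and hence a three-term recurrence. These relations say that the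
  map lowering the \<open>\<tau>\<^sub>j\<^sub>l(A)v\<close> satisfies an Askey-Wilson relation
  \<open>A\<^sup>2\<Psi> - \<beta>A\<Psi>A + \<Psi>A\<^sup>2 - \<gamma>(A\<Psi> + \<Psi>A) - \<rho>\<Psi> = \<kappa>A + \<nu>\<close> on the span of all but the last
  two of them, for fixed \<open>j\<close> and \<open>v\<close>. The relation
  looks the same for both orders, and it determines \<open>\<Psi>\<close> from its values on the first two vectors of
  either sequence.

  The quadratic relation, lemma \<open>eigenvalue_quadratic\<close>, is obtained by writing \<open>A\<^sup>2A\<^sup>*A - AA\<^sup>*A\<^sup>2\<close> as the bracket
  of a polynomial in \<open>A\<close> with \<open>A\<^sup>*\<close> and showing that this polynomial is a cubic if \<open>d \<ge> 3\<close>. The spanning property follows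
  from an argument as for \<open>sl\<^sub>2\<close>-modules, based on the bijections between the split components
  \<open>i\<close> and \<open>d - i\<close>. Both rest on the vanishing of certain intersections of flags, which is how
  irreducibility is used (lemma \<open>flag_meet_eq_0\<close>).
\<close>

section \<open>Newton polynomials of a linear map\<close>

text \<open>
  \<open>newton scl f c m\<close> is \<open>(f - c 0) \<cdots> (f - c (m - 1))\<close>, the polynomial of the Newton basis with nodes
  \<open>c\<close>, evaluated at \<open>f\<close>. With nodes \<open>\<theta>\<^sub>i, \<theta>\<^sub>i\<^sub>+\<^sub>1, \<dots>\<close> it is \<open>\<tau>\<^sub>i\<^sub>,\<^sub>i\<^sub>+\<^sub>m(A)\<close>, with \<open>\<theta>\<^sub>d\<^sub>-\<^sub>i, \<theta>\<^sub>d\<^sub>-\<^sub>i\<^sub>-\<^sub>1, \<dots>\<close> it is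
  the corresponding polynomial for the reversed eigenvalue ordering.
\<close>

fun newton :: "('k::field, 'v::ab_group_add) scl \<Rightarrow> ('v \<Rightarrow> 'v) \<Rightarrow> (nat \<Rightarrow> 'k) \<Rightarrow> nat \<Rightarrow> 'v \<Rightarrow> 'v" where
  "newton scl f c 0 v = v"
| "newton scl f c (Suc m) v = f (newton scl f c m v) - scl (c m) (newton scl f c m v)"

lemma newton_add:
  "newton scl f c (m + n) v = newton scl f (\<lambda>t. c (m + t)) n (newton scl f c m v)"
  by (induction n) simp_all

lemma newton_cong: "(\<And>t. t < m \<Longrightarrow> c t = c' t) \<Longrightarrow> newton scl f c m v = newton scl f c' m v"
  by (induction m) simp_all

lemma newton_Suc_front:
  "newton scl f c (Suc m) v = newton scl f (\<lambda>t. c (Suc t)) m (f v - scl (c 0) v)"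
  by (induction m) simp_all

context vector_space
begin

lemma linear_simps:
  assumes "Vector_Spaces.linear scale scale f"
  shows "f (x + y) = f x + f y" "f (x - y) = f x - f y" "f (scale r x) = scale r (f x)"
    "f 0 = 0" "f (- x) = - f x" "f (sum g I) = (\<Sum>i\<in>I. f (g i))"
proof -
  interpret Vector_Spaces.linear scale scale f by fact
  show "f (x + y) = f x + f y" "f (x - y) = f x - f y" "f (scale r x) = scale r (f x)"
    "f 0 = 0" "f (- x) = - f x" "f (sum g I) = (\<Sum>i\<in>I. f (g i))"
    by (simp_all add: add diff scale zero neg sum)
qed

lemma linear_endoI:
  assumes "\<And>x y. f (x + y) = f x + f y" "\<And>r x. f (scale r x) = scale r (f x)"
  shows "Vector_Spaces.linear scale scale f"
  using assms by unfold_locales auto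

lemma linear_newton:
  assumes "Vector_Spaces.linear scale scale f"
  shows "Vector_Spaces.linear scale scale (newton scale f c m)"
proof (rule linear_endoI)
  show "newton scale f c m (x + y) = newton scale f c m x + newton scale f c m y" for x y
    by (induction m) (simp_all add: linear_simps[OF assms] algebra_simps)
  show "newton scale f c m (scale r x) = scale r (newton scale f c m x)" for r x
    by (induction m) (simp_all add: linear_simps[OF assms] algebra_simps)
qed

lemma linear_image_span_subset:
  assumes "Vector_Spaces.linear scale scale f" "\<And>x. x \<in> X \<Longrightarrow> f x \<in> S" "subspace S" "x \<in> span X"
  shows "f x \<in> S"
  using assms(4)
proof (induction rule: span_induct_alt)
  case base
  then show ?case using assms by (simp add: linear_simps subspace_0)
next
  case (step c x y)
  then show ?case using assms by (simp add: linear_simps subspace_add subspace_scale)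
qed

end

lemma newton_interpolation:
  fixes a :: "nat \<Rightarrow> 'k::field"
  assumes "inj_on a {..m}"
  shows "\<exists>q. \<forall>i\<le>m. (\<Sum>k\<le>m. q k * (\<Prod>t<k. a i - a t)) = z i"
  using assms
proof (induction m)
  case 0
  show ?case by (rule exI[of _ z]) simp
next
  case (Suc m)
  then obtain q where q: "\<And>i. i \<le> m \<Longrightarrow> (\<Sum>k\<le>m. q k * (\<Prod>t<k. a i - a t)) = z i"
    by (auto simp: inj_on_def)
  let ?D = "\<Prod>t<Suc m. a (Suc m) - a t"
  define q' where
    "q' = q (Suc m := (z (Suc m) - (\<Sum>k\<le>m. q k * (\<Prod>t<k. a (Suc m) - a t))) / ?D)"
  have "a (Suc m) \<noteq> a t" if "t < Suc m" for t
    using inj_onD[OF Suc.prems, of "Suc m" t] that by auto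
  then have D: "?D \<noteq> 0" by (simp del: prod.lessThan_Suc)
  have eq: "(\<Sum>k\<le>m. q' k * (\<Prod>t<k. a i - a t)) = (\<Sum>k\<le>m. q k * (\<Prod>t<k. a i - a t))" for i
    by (rule sum.cong) (auto simp: q'_def)
  have "(\<Sum>k\<le>Suc m. q' k * (\<Prod>t<k. a i - a t)) = z i" if "i \<le> Suc m" for i
  proof (cases "i = Suc m")
    case True
    have "q' (Suc m) * ?D = z (Suc m) - (\<Sum>k\<le>m. q k * (\<Prod>t<k. a (Suc m) - a t))"
      using D by (simp add: q'_def del: prod.lessThan_Suc)
    then show ?thesis using True eq by (simp del: prod.lessThan_Suc)
  next
    case False
    then have "(\<Prod>t<Suc m. a i - a t) = 0" using that by (intro prod_zero) auto
    then show ?thesis using q False that eq by (simp del: prod.lessThan_Suc)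
  qed
  then show ?case by blast
qed

section \<open>Diagonalizable maps and tridiagonal systems by components\<close>

text \<open>
  A diagonalizable map given by its primitive idempotents. Letting \<open>E i\<close> vanish for \<open>i > d\<close> makes a
  sum of eigenspaces the same as a set of vectors with prescribed vanishing components, so that all
  later arguments can be checked one component at a time and need no bounds on indices.
\<close>

locale spectral = vector_space scl
  for scl :: "'k::field \<Rightarrow> 'v::ab_group_add \<Rightarrow> 'v" +
  fixes d :: nat and A :: "'v \<Rightarrow> 'v" and E :: "nat \<Rightarrow> 'v \<Rightarrow> 'v" and a :: "nat \<Rightarrow> 'k"
  assumes linear_A: "Vector_Spaces.linear scl scl A"
    and linear_E: "\<And>i. Vector_Spaces.linear scl scl (E i)"
    and E_E: "\<And>i j v. E i (E j v) = (if i = j then E i v else 0)"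
    and E_beyond: "\<And>i v. d < i \<Longrightarrow> E i v = 0"
    and sum_E: "\<And>v. (\<Sum>i\<le>d. E i v) = v"
    and A_E: "\<And>i v. A (E i v) = scl (a i) (E i v)"
    and inj_a: "inj_on a {..d}"
begin

lemmas A_simps = linear_simps[OF linear_A]
lemmas E_simps = linear_simps[OF linear_E]

lemma a_eq_iff: "i \<le> d \<Longrightarrow> j \<le> d \<Longrightarrow> a i = a j \<longleftrightarrow> i = j"
  using inj_a by (auto simp: inj_on_def)

lemma E_A: "E i (A v) = scl (a i) (E i v)"
proof -
  have "E i (A v) = E i (A (\<Sum>j\<le>d. E j v))" by (simp add: sum_E)
  also have "\<dots> = (\<Sum>j\<le>d. scl (a j) (E i (E j v)))" by (simp add: A_simps E_simps A_E)
  also have "\<dots> = (\<Sum>j\<le>d. if j = i then scl (a j) (E i v) else 0)"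
    by (rule sum.cong) (auto simp: E_E)
  also have "\<dots> = scl (a i) (E i v)" using E_beyond by (auto simp: not_le)
  finally show ?thesis .
qed

lemma eqI_components: "(\<And>h. h \<le> d \<Longrightarrow> E h v = E h w) \<Longrightarrow> v = w"
  by (subst sum_E[symmetric], subst (2) sum_E[symmetric]) (rule sum.cong, auto)

lemma eq_0I_components: "(\<And>h. h \<le> d \<Longrightarrow> E h v = 0) \<Longrightarrow> v = 0"
  by (rule eqI_components) (simp add: E_simps)

lemma E_newton: "E h (newton scl A c m v) = scl (\<Prod>t<m. a h - c t) (E h v)"
  by (induction m) (simp_all add: E_simps E_A algebra_simps)

lemma reverse:
  "spectral scl d A (\<lambda>i. if i \<le> d then E (d - i) else (\<lambda>_. 0)) (\<lambda>i. a (d - i))"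
proof (intro spectral.intro spectral_axioms.intro vector_space_axioms linear_A)
  show "Vector_Spaces.linear scl scl (if i \<le> d then E (d - i) else (\<lambda>_. 0))" for i
    by (auto simp: linear_E intro!: linear_endoI)
  show "(\<Sum>i\<le>d. (if i \<le> d then E (d - i) else (\<lambda>_. 0)) v) = v" for v
  proof -
    have "(\<Sum>i\<le>d. (if i \<le> d then E (d - i) else (\<lambda>_. 0)) v) = (\<Sum>i\<le>d. E (d - i) v)"
      by (rule sum.cong) auto
    also have "\<dots> = (\<Sum>i\<le>d. E i v)"
      by (rule sum.reindex_bij_witness[where i="\<lambda>i. d - i" and j="\<lambda>i. d - i"]) auto
    finally show ?thesis by (simp add: sum_E)
  qed
  show "inj_on (\<lambda>i. a (d - i)) {..d}"
    by (rule inj_onI) (use a_eq_iff in force)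
qed (auto simp: E_E A_E A_simps E_simps)

end

text \<open>
  The maps \<open>B\<close>, \<open>F i\<close> and scalars \<open>b i\<close> stand for \<open>A\<^sup>*\<close>, \<open>E\<^sup>*\<^sub>i\<close>, \<open>\<theta>\<^sup>*\<^sub>i\<close>, and \<open>a i\<close> for \<open>\<theta>\<^sub>i\<close>; the subspaces of a
  tridiagonal system are encoded by vanishing components.
  The axioms are symmetric under exchanging the two maps and under reversing either ordering of
  eigenspaces; the reversals are what turn one statement about the first split decomposition into
  statements about all four of them.
\<close>

locale tridiagonal_system = finite_dimensional_vector_space scl Basis +
    EE: spectral scl d A E a + FF: spectral scl d B F b
  for scl :: "'k::field \<Rightarrow> 'v::ab_group_add \<Rightarrow> 'v" and Basis d A E a B F b +
  assumes E_B_E: "\<And>i j v. i + 1 < j \<or> j + 1 < i \<Longrightarrow> E i (B (E j v)) = 0"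
    and F_A_F: "\<And>i j v. i + 1 < j \<or> j + 1 < i \<Longrightarrow> F i (A (F j v)) = 0"
    and E_nonzero: "\<And>i. i \<le> d \<Longrightarrow> \<exists>v. E i v \<noteq> 0"
    and F_nonzero: "\<And>i. i \<le> d \<Longrightarrow> \<exists>v. F i v \<noteq> 0"
    and irreducible: "\<And>S. subspace S \<Longrightarrow> A ` S \<subseteq> S \<Longrightarrow> B ` S \<subseteq> S \<Longrightarrow> S = {0} \<or> S = UNIV"
begin

lemma swap: "tridiagonal_system scl Basis d B F b A E a"
  by unfold_locales (use E_B_E F_A_F E_nonzero F_nonzero irreducible in auto)

lemma reverse_E:
  "tridiagonal_system scl Basis d A (\<lambda>i. if i \<le> d then E (d - i) else (\<lambda>_. 0)) (\<lambda>i. a (d - i)) B F b"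
proof -
  interpret R: spectral scl d A "\<lambda>i. if i \<le> d then E (d - i) else (\<lambda>_. 0)" "\<lambda>i. a (d - i)"
    by (rule EE.reverse)
  show ?thesis
  proof unfold_locales
    show "\<exists>v. (if i \<le> d then E (d - i) else (\<lambda>_. 0)) v \<noteq> 0" if "i \<le> d" for i
      using that E_nonzero[of "d - i"] by auto
    show "(if i \<le> d then E (d - i) else (\<lambda>_. 0)) (B ((if j \<le> d then E (d - j) else (\<lambda>_. 0)) v)) = 0"
      if "i + 1 < j \<or> j + 1 < i" for i j v
    proof (cases "i \<le> d \<and> j \<le> d")
      case True
      with that have "d - i + 1 < d - j \<or> d - j + 1 < d - i" by arith
      with True show ?thesis by (simp add: E_B_E)
    qed (auto simp: EE.E_simps FF.A_simps)
  qed (use E_B_E F_A_F F_nonzero irreducible in \<open>auto simp: EE.E_simps FF.A_simps\<close>)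
qed

lemma reverse_F:
  "tridiagonal_system scl Basis d A E a B (\<lambda>i. if i \<le> d then F (d - i) else (\<lambda>_. 0)) (\<lambda>i. b (d - i))"
proof -
  interpret S: tridiagonal_system scl Basis d B F b A E a by (rule swap)
  interpret T: tridiagonal_system scl Basis d B "\<lambda>i. if i \<le> d then F (d - i) else (\<lambda>_. 0)" "\<lambda>i. b (d - i)" A E a
    by (rule S.reverse_E)
  show ?thesis by (rule T.swap)
qed

lemma E_B_tail:
  assumes "\<And>h. h < j \<Longrightarrow> E h v = 0" "h + 1 < j"
  shows "E h (B v) = 0"
proof -
  have "E h (B v) = E h (B (\<Sum>k\<le>d. E k v))" by (simp add: EE.sum_E)
  also have "\<dots> = (\<Sum>k\<le>d. E h (B (E k v)))" by (simp add: EE.E_simps FF.A_simps)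
  also have "\<dots> = 0"
  proof (rule sum.neutral, intro ballI)
    fix k
    show "E h (B (E k v)) = 0"
      using assms E_B_E[of h k v] by (cases "k < j") (auto simp: EE.E_simps FF.A_simps)
  qed
  finally show ?thesis .
qed

lemma F_A_head:
  assumes "\<And>h. h > i \<Longrightarrow> F h v = 0" "h > i + 1"
  shows "F h (A v) = 0"
proof -
  have "F h (A v) = F h (A (\<Sum>k\<le>d. F k v))" by (simp add: FF.sum_E)
  also have "\<dots> = (\<Sum>k\<le>d. F h (A (F k v)))" by (simp add: EE.A_simps FF.E_simps)
  also have "\<dots> = 0"
  proof (rule sum.neutral, intro ballI)
    fix k
    show "F h (A (F k v)) = 0"
      using assms F_A_F[of h k v] by (cases "k > i") (auto simp: EE.A_simps FF.E_simps)
  qed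
  finally show ?thesis .
qed

section \<open>Intersections of flags\<close>

text \<open>
  The intersection of two flags, \<open>(E\<^sup>*\<^sub>0V + \<cdots> + E\<^sup>*\<^sub>iV) \<inter> (E\<^sub>jV + \<cdots> + E\<^sub>dV)\<close>. For \<open>i = j\<close> it is the \<open>i\<close>-th component of
  the first split decomposition; in the system with reversed \<open>E\<close> it is \<open>U\<^sub>i\<^sup>\<Down>\<close>.
\<close>

definition flag_meet :: "nat \<Rightarrow> nat \<Rightarrow> 'v set" where
  "flag_meet i j = {v. (\<forall>h>i. F h v = 0) \<and> (\<forall>h<j. E h v = 0)}"

lemma subspace_flag_meet: "subspace (flag_meet i j)"
  by (auto simp: flag_meet_def intro!: subspaceI simp: EE.E_simps FF.E_simps)

lemma A_flag_meet: "v \<in> flag_meet i j \<Longrightarrow> A v - scl (a j) v \<in> flag_meet (i + 1) (j + 1)"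
  using F_A_head[of i v] by (auto simp: flag_meet_def EE.E_simps FF.E_simps EE.E_A less_Suc_eq)

lemma B_flag_meet:
  assumes "v \<in> flag_meet (Suc i) j"
  shows "B v - scl (b (Suc i)) v \<in> flag_meet i (j - 1)"
proof -
  have "F h (B v - scl (b (Suc i)) v) = 0" if "h > i" for h
    using assms that by (cases "h = Suc i") (auto simp: flag_meet_def FF.E_simps FF.E_A)
  then show ?thesis
    using assms E_B_tail[of j v] by (auto simp: flag_meet_def EE.E_simps)
qed

lemma B_flag_meet_0:
  assumes "v \<in> flag_meet 0 j"
  shows "B v - scl (b 0) v = 0"
proof (rule FF.eq_0I_components)
  fix h
  show "F h (B v - scl (b 0) v) = 0"
    using assms by (cases "h = 0") (auto simp: flag_meet_def FF.E_simps FF.E_A)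
qed

lemma newton_flag_meet: "v \<in> flag_meet i j \<Longrightarrow> newton scl A (\<lambda>t. a (j + t)) m v \<in> flag_meet (i + m) (j + m)"
proof (induction m)
  case (Suc m)
  then show ?case using A_flag_meet[of _ "i + m" "j + m"] by simp
qed simp

text \<open>
  Irreducibility enters here and nowhere else. The maps \<open>A - \<theta>\<^sub>j\<close> and \<open>A\<^sup>* - \<theta>\<^sup>*\<^sub>i\<close> move the intersection with
  indices \<open>(i, j)\<close> into those with indices \<open>(i + 1, j + 1)\<close> and \<open>(i - 1, j - 1)\<close>, so the sum of all
  intersections with a fixed difference \<open>j - i\<close> is invariant. For a positive difference it lies in the
  kernel of \<open>E\<^sub>0\<close>, hence it is zero.
\<close>

lemma flag_meet_eq_0:
  assumes "v \<in> flag_meet i j" "i < j"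
  shows "v = 0"
proof -
  define X where "X = (\<Union>k. flag_meet k (k + (j - i)))"
  have AX: "A x \<in> span X" if "x \<in> X" for x
  proof -
    obtain k where k: "x \<in> flag_meet k (k + (j - i))" using \<open>x \<in> X\<close> unfolding X_def by blast
    have "A x - scl (a (k + (j - i))) x \<in> flag_meet (k + 1) (k + 1 + (j - i))"
      using A_flag_meet[OF k] by simp
    then have "A x - scl (a (k + (j - i))) x \<in> span X"
      unfolding X_def by (intro span_base) blast
    moreover have "scl (a (k + (j - i))) x \<in> span X"
      using that by (intro span_scale span_base)
    ultimately have "(A x - scl (a (k + (j - i))) x) + scl (a (k + (j - i))) x \<in> span X"
      by (rule span_add)
    then show ?thesis by simp
  qed
  have BX: "B x \<in> span X" if "x \<in> X" for x
  proof -
    obtain k where k: "x \<in> flag_meet k (k + (j - i))" using \<open>x \<in> X\<close> unfolding X_def by blast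
    have "B x - scl (b k) x \<in> span X"
    proof (cases k)
      case 0
      then show ?thesis using B_flag_meet_0[of x "j - i"] k by (simp add: span_zero del: right_minus_eq)
    next
      case (Suc l)
      then have "B x - scl (b k) x \<in> flag_meet l (l + (j - i))" using B_flag_meet[of x l "k + (j - i)"] k by simp
      then show ?thesis by (intro span_base) (auto simp: X_def)
    qed
    moreover have "scl (b k) x \<in> span X"
      using that by (intro span_scale span_base)
    ultimately have "(B x - scl (b k) x) + scl (b k) x \<in> span X"
      by (rule span_add)
    then show ?thesis by simp
  qed
  have "span X = {0} \<or> span X = UNIV"
  proof (rule irreducible)
    show "A ` span X \<subseteq> span X"
      using linear_image_span_subset[OF EE.linear_A AX subspace_span] by blast
    show "B ` span X \<subseteq> span X"
      using linear_image_span_subset[OF FF.linear_A BX subspace_span] by blast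
  qed simp
  moreover have "span X \<noteq> UNIV"
  proof
    assume "span X = UNIV"
    moreover have "E 0 x \<in> {0}" if "x \<in> span X" for x
      by (rule linear_image_span_subset[OF EE.linear_E _ _ that])
        (use assms in \<open>auto simp: X_def flag_meet_def\<close>)
    ultimately show False using E_nonzero[of 0] by auto
  qed
  moreover have "v \<in> span X"
    using assms by (intro span_base) (auto simp: X_def intro!: exI[of _ i])
  ultimately show ?thesis by auto
qed

lemma heads_meet_eq_0:
  assumes "\<And>h. h > i \<Longrightarrow> F h v = 0" "\<And>h. d \<le> h + i \<Longrightarrow> E h v = 0" "i < d"
  shows "v = 0"
proof -
  interpret R: tridiagonal_system scl Basis d A "\<lambda>i. if i \<le> d then E (d - i) else (\<lambda>_. 0)" "\<lambda>i. a (d - i)" B F b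
    by (rule reverse_E)
  show ?thesis
    by (rule R.flag_meet_eq_0[of v i "Suc i"]) (use assms in \<open>auto simp: R.flag_meet_def\<close>)
qed

lemma tails_meet_eq_0:
  assumes "\<And>h. h \<le> i \<Longrightarrow> F h v = 0" "\<And>h. h + i < d \<Longrightarrow> E h v = 0" "i < d"
  shows "v = 0"
proof -
  interpret R: tridiagonal_system scl Basis d A E a B "\<lambda>i. if i \<le> d then F (d - i) else (\<lambda>_. 0)" "\<lambda>i. b (d - i)"
    by (rule reverse_F)
  show ?thesis
    by (rule R.flag_meet_eq_0[of v "d - Suc i" "d - i"]) (use assms in \<open>auto simp: R.flag_meet_def\<close>)
qed

section \<open>Split components as spans of translates of the lowest spaces\<close>

definition K_space :: "nat \<Rightarrow> 'v set" where
  "K_space i = {v. (\<forall>h>i. F h v = 0) \<and> (\<forall>h. h < i \<or> d - i < h \<longrightarrow> E h v = 0)}"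

lemma newton_B_flag_meet:
  "v \<in> flag_meet (i + m) (j + m) \<Longrightarrow> newton scl B (\<lambda>t. b (i + m - t)) m v \<in> flag_meet i j"
proof (induction m arbitrary: i j)
  case (Suc m)
  have "newton scl B (\<lambda>t. b (Suc i + m - t)) m v \<in> flag_meet (Suc i) (Suc j)"
    using Suc.IH[of "Suc i" "Suc j"] Suc.prems by simp
  from B_flag_meet[OF this] show ?case by simp
qed simp

text \<open>
  The map \<open>(A - \<theta>\<^sub>i) \<cdots> (A - \<theta>\<^sub>d\<^sub>-\<^sub>i\<^sub>-\<^sub>1)\<close> from the \<open>i\<close>-th to the \<open>(d-i)\<close>-th split component is injective: a kernel
  vector has no component in \<open>E\<^sub>hV\<close> for \<open>h \<ge> d - i\<close>, so it lies in two initial segments that intersect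
  trivially. The analogous product in \<open>A\<^sup>*\<close> is an injection in the opposite direction, so the
  dimensions agree and the first map is onto.
\<close>

lemma newton_onto_mirror:
  assumes "2 * i \<le> d" "w \<in> flag_meet (d - i) (d - i)"
  obtains u where "u \<in> flag_meet i i" "newton scl A (\<lambda>t. a (i + t)) (d - 2 * i) u = w"
proof -
  define m where "m = d - 2 * i"
  define f where "f = newton scl A (\<lambda>t. a (i + t)) m"
  define g where "g = newton scl B (\<lambda>t. b (d - i - t)) m"
  interpret pair: finite_dimensional_vector_space_pair scl Basis scl Basis
    by unfold_locales
  have im: "i + m = d - i" using assms by (simp add: m_def)
  have lf: "Vector_Spaces.linear scl scl f" and lg: "Vector_Spaces.linear scl scl g"
    by (simp_all add: f_def g_def linear_newton EE.linear_A FF.linear_A)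
  have fU: "f ` flag_meet i i \<subseteq> flag_meet (d - i) (d - i)"
    using newton_flag_meet[of _ i i m] by (auto simp: f_def im)
  have gU: "g ` flag_meet (d - i) (d - i) \<subseteq> flag_meet i i"
    using newton_B_flag_meet[of _ i m i] by (auto simp: g_def im)
  have f0: "v = 0" if v: "v \<in> flag_meet i i" "f v = 0" for v
  proof (cases "i < d")
    case True
    show ?thesis
    proof (rule heads_meet_eq_0[of i])
      fix h assume h: "d \<le> h + i"
      show "E h v = 0"
      proof (cases "h \<le> d")
        case True
        have "scl (\<Prod>t<m. a h - a (i + t)) (E h v) = 0"
          using v(2) EE.E_newton[of h "\<lambda>t. a (i + t)" m v] by (simp add: f_def EE.E_simps)
        moreover have "a h - a (i + t) \<noteq> 0" if "t < m" for t
          using that h im True EE.a_eq_iff[of h "i + t"] by auto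
        ultimately show ?thesis by simp
      qed (simp add: EE.E_beyond)
    qed (use v True in \<open>auto simp: flag_meet_def\<close>)
  next
    case False
    then show ?thesis using v assms(1) by (simp add: f_def m_def)
  qed
  have g0: "v = 0" if v: "v \<in> flag_meet (d - i) (d - i)" "g v = 0" for v
  proof (cases "i < d")
    case True
    show ?thesis
    proof (rule tails_meet_eq_0[of i])
      fix h assume h: "h \<le> i"
      have "scl (\<Prod>t<m. b h - b (d - i - t)) (F h v) = 0"
        using v(2) FF.E_newton[of h "\<lambda>t. b (d - i - t)" m v] by (simp add: g_def FF.E_simps)
      moreover have "b h - b (d - i - t) \<noteq> 0" if "t < m" for t
        using that h im True FF.a_eq_iff[of h "d - i - t"] by auto
      ultimately show "F h v = 0" by simp
    qed (use v True in \<open>auto simp: flag_meet_def\<close>)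
  next
    case False
    then show ?thesis using v assms(1) by (simp add: g_def m_def)
  qed
  have inj: "inj_on k S" if "Vector_Spaces.linear scl scl k" "subspace S"
    "\<And>v. v \<in> S \<Longrightarrow> k v = 0 \<Longrightarrow> v = 0" for k S
  proof (rule inj_onI)
    fix x y assume "x \<in> S" "y \<in> S" "k x = k y"
    then have "k (x - y) = 0" by (simp add: linear_simps[OF that(1)])
    moreover have "x - y \<in> S" using \<open>x \<in> S\<close> \<open>y \<in> S\<close> by (rule subspace_diff[OF that(2)])
    ultimately have "x - y = 0" using that(3) by blast
    then show "x = y" by simp
  qed
  have "dim (f ` flag_meet i i) = dim (flag_meet i i)"
    using inj[OF lf subspace_flag_meet f0] by (intro pair.dim_image_eq lf) (simp add: span_eq_iff[THEN iffD2, OF subspace_flag_meet])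
  moreover have "dim (g ` flag_meet (d - i) (d - i)) = dim (flag_meet (d - i) (d - i))"
    using inj[OF lg subspace_flag_meet g0] by (intro pair.dim_image_eq lg) (simp add: span_eq_iff[THEN iffD2, OF subspace_flag_meet])
  moreover have "dim (g ` flag_meet (d - i) (d - i)) \<le> dim (flag_meet i i)"
    by (rule dim_subset) (rule gU)
  ultimately have le: "dim (flag_meet (d - i) (d - i)) \<le> dim (f ` flag_meet i i)" by simp
  have "f ` flag_meet i i = flag_meet (d - i) (d - i)"
    by (rule subspace_dim_equal[OF pair.linear_subspace_image[OF lf subspace_flag_meet] subspace_flag_meet fU le])
  then have "w \<in> f ` flag_meet i i" using assms(2) by simp
  then obtain u where "u \<in> flag_meet i i" "f u = w" by (elim imageE) simp
  then show ?thesis using that by (simp add: f_def m_def)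
qed

text \<open>
  The argument is the one for lowest weight vectors of an \<open>sl\<^sub>2\<close>-module: pushing \<open>x\<close> up to component \<open>d - i\<close>
  and using surjectivity from component \<open>i\<close> gives a \<open>w\<close> such that \<open>x - (A - \<theta>\<^sub>i)w\<close> is killed by
  \<open>(A - \<theta>\<^sub>i\<^sub>+\<^sub>1) \<cdots> (A - \<theta>\<^sub>d\<^sub>-\<^sub>i\<^sub>-\<^sub>1)\<close>, which for a vector of the split component means lying in \<open>K\<^sub>i\<^sub>+\<^sub>1\<close>.
\<close>

lemma flag_meet_step:
  assumes "2 * Suc i \<le> d" "x \<in> flag_meet (Suc i) (Suc i)"
  obtains w where "w \<in> flag_meet i i" "x - (A w - scl (a i) w) \<in> K_space (Suc i)"
proof -
  define m where "m = d - 2 * Suc i + 1"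
  have "newton scl A (\<lambda>t. a (Suc i + t)) m x \<in> flag_meet (d - i) (d - i)"
  proof -
    have "Suc i + m = d - i" using assms(1) by (simp add: m_def)
    then show ?thesis using newton_flag_meet[OF assms(2), of m] by simp
  qed
  then obtain w where w: "w \<in> flag_meet i i"
      "newton scl A (\<lambda>t. a (i + t)) (Suc m) w = newton scl A (\<lambda>t. a (Suc i + t)) m x"
  proof -
    have "d - 2 * i = Suc m" "2 * i \<le> d" using assms(1) by (simp_all add: m_def)
    then show ?thesis
      using newton_onto_mirror[of i "newton scl A (\<lambda>t. a (Suc i + t)) m x"] that
        \<open>newton scl A (\<lambda>t. a (Suc i + t)) m x \<in> flag_meet (d - i) (d - i)\<close> by metis
  qed
  let ?y = "x - (A w - scl (a i) w)"
  have "A w - scl (a i) w \<in> flag_meet (Suc i) (Suc i)"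
    using A_flag_meet[OF w(1)] by simp
  then have y: "?y \<in> flag_meet (Suc i) (Suc i)"
    by (rule subspace_diff[OF subspace_flag_meet assms(2)])
  have "newton scl A (\<lambda>t. a (Suc i + t)) m ?y = 0"
    using w(2) unfolding newton_Suc_front
    by (simp add: linear_simps[OF linear_newton[OF EE.linear_A]])
  then have *: "scl (\<Prod>t<m. a h - a (Suc i + t)) (E h ?y) = 0" for h
    by (metis EE.E_newton EE.E_simps(4))
  have "E h ?y = 0" if h: "d - Suc i < h" for h
  proof (cases "h \<le> d")
    case True
    have "a h - a (Suc i + t) \<noteq> 0" if "t < m" for t
      using that h True assms(1) EE.a_eq_iff[of h "Suc i + t"] by (auto simp: m_def)
    then show ?thesis using *[of h] by simp
  qed (simp add: EE.E_beyond)
  then have "?y \<in> K_space (Suc i)" using y by (auto simp: K_space_def flag_meet_def)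
  with w(1) show ?thesis by (rule that)
qed

text \<open>
  The translates of the spaces \<open>K\<^sub>j\<close> that land in the \<open>i\<close>-th split component.
\<close>

definition K_translates :: "nat \<Rightarrow> 'v set" where
  "K_translates i = (\<Union>j\<in>{j. j \<le> i \<and> j \<le> d - i}. newton scl A (\<lambda>t. a (j + t)) (i - j) ` K_space j)"

lemma K_translatesI: "j \<le> i \<Longrightarrow> j \<le> d - i \<Longrightarrow> k \<in> K_space j \<Longrightarrow> newton scl A (\<lambda>t. a (j + t)) (i - j) k \<in> K_translates i"
  unfolding K_translates_def by blast

lemma flag_meet_span_half: "2 * i \<le> d \<Longrightarrow> x \<in> flag_meet i i \<Longrightarrow> x \<in> span (K_translates i)"
proof (induction i arbitrary: x)
  case 0
  then have "x \<in> K_space 0" by (auto simp: K_space_def flag_meet_def EE.E_beyond)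
  then show ?case by (intro span_base) (auto simp: K_translates_def)
next
  case (Suc i)
  obtain w where w: "w \<in> flag_meet i i" "x - (A w - scl (a i) w) \<in> K_space (Suc i)"
    using flag_meet_step Suc.prems by blast
  have "Vector_Spaces.linear scl scl (\<lambda>w. A w - scl (a i) w)"
    by (rule linear_endoI) (simp_all add: EE.A_simps algebra_simps)
  then have "A w - scl (a i) w \<in> span (K_translates (Suc i))"
  proof (rule linear_image_span_subset)
    show "w \<in> span (K_translates i)" using Suc w by simp
    fix y assume "y \<in> K_translates i"
    then obtain j k where j: "j \<le> i" "y = newton scl A (\<lambda>t. a (j + t)) (i - j) k" "k \<in> K_space j"
      by (auto simp: K_translates_def)
    then have "A y - scl (a i) y = newton scl A (\<lambda>t. a (j + t)) (Suc i - j) k"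
      by (simp add: Suc_diff_le)
    moreover have "j \<le> d - Suc i" using j Suc.prems by simp
    ultimately show "A y - scl (a i) y \<in> span (K_translates (Suc i))"
      using j K_translatesI[of j "Suc i" k] by (simp add: span_base)
  qed simp
  moreover have "x - (A w - scl (a i) w) \<in> span (K_translates (Suc i))"
  proof (rule span_base)
    have "Suc i \<le> d - Suc i" using Suc.prems by simp
    then show "x - (A w - scl (a i) w) \<in> K_translates (Suc i)" using w(2) K_translatesI[of "Suc i" "Suc i"] by simp
  qed
  ultimately have "(x - (A w - scl (a i) w)) + (A w - scl (a i) w) \<in> span (K_translates (Suc i))"
    by (rule span_add[rotated])
  then show ?case by simp
qed

text \<open>
  Above the middle, every element of a split component comes from the mirror component below the
  middle by \<open>newton_onto_mirror\<close>.
\<close>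

lemma flag_meet_span:
  assumes "i \<le> d" "x \<in> flag_meet i i"
  shows "x \<in> span (K_translates i)"
proof (cases "2 * i \<le> d")
  case False
  define i' where "i' = d - i"
  have i': "2 * i' \<le> d" "d - i' = i" "d - 2 * i' = i - i'" "i' \<le> i"
    using False assms by (auto simp: i'_def)
  have "x \<in> flag_meet (d - i') (d - i')" unfolding i'(2) by (rule assms(2))
  from newton_onto_mirror[OF i'(1) this]
  obtain u where u: "u \<in> flag_meet i' i'" "newton scl A (\<lambda>t. a (i' + t)) (i - i') u = x"
    unfolding i'(3) by blast
  have "newton scl A (\<lambda>t. a (i' + t)) (i - i') u \<in> span (K_translates i)"
  proof (rule linear_image_span_subset[OF linear_newton[OF EE.linear_A]])
    show "u \<in> span (K_translates i')" using u i' flag_meet_span_half by simp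
    fix y assume "y \<in> K_translates i'"
    then obtain j k where j: "j \<le> i'" "y = newton scl A (\<lambda>t. a (j + t)) (i' - j) k" "k \<in> K_space j"
      by (auto simp: K_translates_def)
    then have "newton scl A (\<lambda>t. a (i' + t)) (i - i') y = newton scl A (\<lambda>t. a (j + t)) (i - j) k"
      using newton_add[of scl A "\<lambda>t. a (j + t)" "i' - j" "i - i'" k] i' by (simp add: add.assoc)
    then show "newton scl A (\<lambda>t. a (i' + t)) (i - i') y \<in> span (K_translates i)"
      using j i' K_translatesI[of j i k] by (simp add: span_base i'_def)
  qed simp
  with u show ?thesis by simp
qed (use assms flag_meet_span_half in simp)

section \<open>The quadratic relation between consecutive eigenvalues\<close>

lemma F_newton_eq_0: 
  assumes "\<And>h. 0 < h \<Longrightarrow> F h v = 0" "m < h"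
  shows "F h (newton scl A c m v) = 0"
  using assms(2)
proof (induction m arbitrary: h)
  case (Suc m)
  have "F h (A (newton scl A c m v)) = 0"
    by (rule F_A_head[of m]) (use Suc in auto)
  then show ?case using Suc by (simp add: FF.E_simps)
qed (use assms in simp)

text \<open>
  If the component vanished, \<open>\<tau>\<^sub>0\<^sub>,\<^sub>m(A)v\<close> would lie in a zero intersection of flags, so \<open>v\<close> would be
  supported on \<open>E\<^sub>0V, \<dots>, E\<^sub>m\<^sub>-\<^sub>1V\<close>, which meets \<open>E\<^sup>*\<^sub>0V\<close> trivially.
\<close>

lemma F_newton_nonzero:
  assumes v: "\<And>h. 0 < h \<Longrightarrow> F h v = 0" "v \<noteq> 0" and m: "m \<le> d" and d: "0 < d"
  shows "F m (newton scl A a m v) \<noteq> 0"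
proof
  let ?x = "newton scl A a m v"
  assume Fm: "F m ?x = 0"
  have "v \<in> flag_meet 0 0" using v by (auto simp: flag_meet_def)
  then have x: "?x \<in> flag_meet m m" using newton_flag_meet[of v 0 0 m] by simp
  have "?x = 0"
  proof (cases m)
    case 0
    show ?thesis
    proof (rule FF.eq_0I_components)
      fix h
      show "F h ?x = 0" using x \<open>F m ?x = 0\<close> 0 by (cases "h = 0") (auto simp: flag_meet_def)
    qed
  next
    case (Suc k)
    have "F h ?x = 0" if "h > k" for h using x Fm Suc that by (cases "h = m") (auto simp: flag_meet_def)
    then have "?x \<in> flag_meet k m" using x by (auto simp: flag_meet_def)
    then show ?thesis using flag_meet_eq_0 Suc by blast
  qed
  have "v = 0"
  proof (rule heads_meet_eq_0[of 0])
    fix h assume h: "d \<le> h + 0"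
    show "E h v = 0"
    proof (cases "h = d")
      case True
      have "scl (\<Prod>t<m. a h - a t) (E h v) = 0"
        using \<open>?x = 0\<close> EE.E_newton[of h a m v] by (simp add: EE.E_simps)
      moreover have "a h - a t \<noteq> 0" if "t < m" for t
        using that m True EE.a_eq_iff[of h t] by auto
      ultimately show ?thesis by simp
    qed (use h EE.E_beyond in auto)
  qed (use v d in auto)
  then show False using v by simp
qed

text \<open>
  By tridiagonality a map of the form \<open>\<Sum> x\<^sub>i\<^sub>j E\<^sub>iA\<^sup>*E\<^sub>j\<close> with antisymmetric coefficients only involves the
  differences \<open>E\<^sub>iA\<^sup>*E\<^sub>i\<^sub>+\<^sub>1 - E\<^sub>i\<^sub>+\<^sub>1A\<^sup>*E\<^sub>i\<close>, and these are the brackets of \<open>E\<^sub>0 + \<cdots> + E\<^sub>i\<close> with \<open>A\<^sup>*\<close>. So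
  \<open>A\<^sup>2A\<^sup>*A - AA\<^sup>*A\<^sup>2\<close> is \<open>ZA\<^sup>* - A\<^sup>*Z\<close> for a polynomial \<open>Z\<close> in \<open>A\<close> whose consecutive
  eigenvalues have prescribed differences. Expressing \<open>Z\<close> in the Newton basis makes its degree visible on \<open>E\<^sup>*\<^sub>0V\<close>.
\<close>

lemma commutator_as_bracket:
  obtains Z q where "Vector_Spaces.linear scl scl Z"
    "\<And>x. Z x = (\<Sum>k\<le>d. scl (q k) (newton scl A a k x))"
    "\<And>x. A (A (B (A x))) - A (B (A (A x))) = Z (B x) - B (Z x)"
    "\<And>i. i < d \<Longrightarrow> (\<Sum>k\<le>d. q k * (\<Prod>t<k. a (Suc i) - a t)) - (\<Sum>k\<le>d. q k * (\<Prod>t<k. a i - a t))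
       = a i * a (Suc i) * (a (Suc i) - a i)"
proof -
  define z where "z i = (\<Sum>h<i. a h * a (Suc h) * (a (Suc h) - a h))" for i
  obtain q where q: "\<And>i. i \<le> d \<Longrightarrow> (\<Sum>k\<le>d. q k * (\<Prod>t<k. a i - a t)) = z i"
    using newton_interpolation[OF EE.inj_a] by blast
  define Z where "Z x = (\<Sum>k\<le>d. scl (q k) (newton scl A a k x))" for x
  note lN = linear_simps[OF linear_newton[OF EE.linear_A]]
  have lZ: "Vector_Spaces.linear scl scl Z"
    by (rule linear_endoI)
      (simp_all add: Z_def lN scale_right_distrib sum.distrib scale_sum_right mult.commute)
  note Zs = linear_simps[OF lZ]
  have EZ: "E h (Z x) = scl (z h) (E h x)" if "h \<le> d" for h x
  proof -
    have "E h (Z x) = (\<Sum>k\<le>d. scl (q k * (\<Prod>t<k. a h - a t)) (E h x))"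
      by (simp add: Z_def EE.E_simps EE.E_newton)
    also have "\<dots> = scl (z h) (E h x)" using q[OF that] by (simp flip: scale_sum_left)
    finally show ?thesis .
  qed
  have ZE: "Z (E h x) = scl (z h) (E h x)" if "h \<le> d" for h x
    by (rule EE.eqI_components) (auto simp: EZ EE.E_E EE.E_simps)
  have comm: "A (A (B (A x))) - A (B (A (A x))) = Z (B x) - B (Z x)" for x
  proof -
    let ?L = "\<lambda>x. A (A (B (A x))) - A (B (A (A x))) - (Z (B x) - B (Z x))"
    have L: "Vector_Spaces.linear scl scl ?L"
      by (rule linear_endoI) (simp_all add: EE.A_simps FF.A_simps Zs algebra_simps)
    have "?L (E k y) = 0" if k: "k \<le> d" for k y
    proof (rule EE.eq_0I_components)
      fix h assume h: "h \<le> d"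
      have *: "E h (?L (E k y)) =
          scl (a h * a h * a k - a h * a k * a k - (z h - z k)) (E h (B (E k y)))"
        using h k by (simp add: EE.E_simps EE.A_simps FF.A_simps EE.A_E EE.E_A EZ ZE algebra_simps)
      consider "h + 1 < k \<or> k + 1 < h" | "h = k" | "k = Suc h" | "h = Suc k" by linarith
      then show "E h (?L (E k y)) = 0"
      proof cases
        case 1 then show ?thesis unfolding * by (simp add: E_B_E)
      qed (unfold *, simp_all add: z_def algebra_simps)
    qed
    then have "?L (\<Sum>k\<le>d. E k x) = 0"
      unfolding linear_simps(6)[OF L] by (intro sum.neutral) auto
    then show ?thesis by (simp add: EE.sum_E)
  qed
  show ?thesis
  proof (rule that[OF lZ Z_def comm])
    fix i assume "i < d"
    then show "(\<Sum>k\<le>d. q k * (\<Prod>t<k. a (Suc i) - a t)) - (\<Sum>k\<le>d. q k * (\<Prod>t<k. a i - a t))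
       = a i * a (Suc i) * (a (Suc i) - a i)"
      by (simp add: q) (simp add: z_def)
  qed
qed

text \<open>
  The polynomial \<open>Z\<close> of \<open>commutator_as_bracket\<close> has degree exactly 3 when \<open>d \<ge> 3\<close>. To see this, apply both sides of
  the identity to a nonzero \<open>v\<close> in \<open>E\<^sup>*\<^sub>0V\<close> and take components in \<open>E\<^sup>*\<^sub>hV\<close>. The left side has none for
  \<open>h > 3\<close> and has \<open>(\<theta>\<^sup>*\<^sub>1 - \<theta>\<^sup>*\<^sub>2)E\<^sup>*\<^sub>3A\<^sup>3v \<noteq> 0\<close> for \<open>h = 3\<close>, while the right side is
  \<open>(\<theta>\<^sup>*\<^sub>0 - \<theta>\<^sup>*\<^sub>h)E\<^sup>*\<^sub>hZv\<close>, which is nonzero when \<open>h\<close> is the degree of \<open>Z\<close> and positive. Dividing the known difference of the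
  values of the cubic \<open>Z\<close> at \<open>\<theta>\<^sub>i\<^sub>+\<^sub>1\<close> and \<open>\<theta>\<^sub>i\<close> by \<open>\<theta>\<^sub>i\<^sub>+\<^sub>1 - \<theta>\<^sub>i\<close> leaves the symmetric quadratic relation. For
  \<open>d \<le> 2\<close> there are at most two conditions, and \<open>\<beta> = 0\<close> works.
\<close>

lemma eigenvalue_quadratic:
  "\<exists>\<beta> \<gamma> \<rho>. \<forall>i<d. (a i)^2 - \<beta> * a i * a (i + 1) + (a (i + 1))^2 - \<gamma> * (a i + a (i + 1)) - \<rho> = 0"
proof (cases "d \<le> 2")
  case True
  have "\<forall>i<d. (a i)^2 - 0 * a i * a (i + 1) + (a (i + 1))^2 - (a 0 + a 2) * (a i + a (i + 1))
      - ((a 1)^2 - a 0 * a 1 - a 0 * a 2 - a 1 * a 2) = 0"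
  proof (intro allI impI)
    fix i assume "i < d"
    then consider "i = 0" | "i = 1" using True by linarith
    then show "(a i)^2 - 0 * a i * a (i + 1) + (a (i + 1))^2 - (a 0 + a 2) * (a i + a (i + 1))
      - ((a 1)^2 - a 0 * a 1 - a 0 * a 2 - a 1 * a 2) = 0"
      by cases (simp_all add: power2_eq_square algebra_simps numeral_2_eq_2)
  qed
  then show ?thesis by blast
next
  case False
  obtain Z q where Z: "Vector_Spaces.linear scl scl Z"
    "\<And>x. Z x = (\<Sum>k\<le>d. scl (q k) (newton scl A a k x))"
    "\<And>x. A (A (B (A x))) - A (B (A (A x))) = Z (B x) - B (Z x)"
    "\<And>i. i < d \<Longrightarrow> (\<Sum>k\<le>d. q k * (\<Prod>t<k. a (Suc i) - a t)) - (\<Sum>k\<le>d. q k * (\<Prod>t<k. a i - a t))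
       = a i * a (Suc i) * (a (Suc i) - a i)"
    by (rule commutator_as_bracket) (rule that)
  obtain y where "F 0 y \<noteq> 0" using F_nonzero by blast
  define v where "v = F 0 y"
  have v: "v \<noteq> 0" "\<And>h. 0 < h \<Longrightarrow> F h v = 0" "B v = scl (b 0) v"
    using \<open>F 0 y \<noteq> 0\<close> by (auto simp: v_def FF.E_E FF.A_E)
  let ?N = "\<lambda>k. newton scl A a k v"
  have N0: "F h (?N k) = 0" if "k < h" for h k by (rule F_newton_eq_0) (use v that in auto)
  have N1: "F k (?N k) \<noteq> 0" if "k \<le> d" for k by (rule F_newton_nonzero) (use v that False in auto)
  have A1: "F h (A v) = 0" if "h > 1" for h using F_A_head[of 0 v h] v that by auto
  have A2: "F h (A (A v)) = 0" if "h > 2" for h using F_A_head[of 1 "A v" h] A1 that by auto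
  have A3: "F h (A (A (A v))) = 0" if "h > 3" for h using F_A_head[of 2 "A (A v)" h] A2 that by auto
  have bracket: "F h (A (A (B (A v))) - A (B (A (A v)))) = scl (b 0 - b h) (F h (Z v))" for h
    by (simp add: Z(3) v FF.E_simps FF.E_A linear_simps[OF Z(1)] algebra_simps)
  have b1: "F h (B (A v) - scl (b 1) (A v)) = 0" if "h > 0" for h
    using A1[of h] that by (cases "h = 1") (auto simp: FF.E_simps FF.E_A)
  have b1': "F h (A (B (A v) - scl (b 1) (A v))) = 0" if "h > 1" for h
    using F_A_head[of 0 "B (A v) - scl (b 1) (A v)" h] b1 that by auto
  have b1'': "F h (A (A (B (A v) - scl (b 1) (A v)))) = 0" if "h > 2" for h
    using F_A_head[of 1 "A (B (A v) - scl (b 1) (A v))" h] b1' that by auto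
  have b2: "F h (B (A (A v)) - scl (b 2) (A (A v))) = 0" if "h > 1" for h
    using A2[of h] that by (cases "h = 2") (auto simp: FF.E_simps FF.E_A)
  have b2': "F h (A (B (A (A v)) - scl (b 2) (A (A v)))) = 0" if "h > 2" for h
    using F_A_head[of 1 "B (A (A v)) - scl (b 2) (A (A v))" h] b2 that by auto
  have comm: "F h (A (A (B (A v))) - A (B (A (A v)))) = scl (b 1 - b 2) (F h (A (A (A v))))"
    if "h > 2" for h
    using b1''[OF that] b2'[OF that] by (simp add: EE.A_simps FF.E_simps algebra_simps)
  have main: "scl (b 0 - b h) (F h (Z v)) = scl (b 1 - b 2) (F h (A (A (A v))))" if "h > 2" for h
    using bracket[of h] comm[OF that] by simp
  have FZ: "F h (Z v) = scl (q h) (F h (?N h))" if "h \<le> d" "\<And>k. h < k \<Longrightarrow> k \<le> d \<Longrightarrow> q k = 0" for h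
  proof -
    have "F h (Z v) = (\<Sum>k\<le>d. scl (q k) (F h (?N k)))" by (simp add: Z(2) FF.E_simps)
    also have "\<dots> = (\<Sum>k\<le>d. if k = h then scl (q h) (F h (?N h)) else 0)"
    proof (rule sum.cong)
      fix k assume "k \<in> {..d}"
      then show "scl (q k) (F h (?N k)) = (if k = h then scl (q h) (F h (?N h)) else 0)"
        using N0[of k h] that(2)[of k] by (cases k h rule: linorder_cases) auto
    qed simp
    also have "\<dots> = scl (q h) (F h (?N h))" using that by simp
    finally show ?thesis .
  qed
  have q_high: "q k = 0" if "3 < k" "k \<le> d" for k
  proof (rule ccontr)
    assume "q k \<noteq> 0"
    define m where "m = Max {k. k \<le> d \<and> q k \<noteq> 0}"
    have fin: "finite {k. k \<le> d \<and> q k \<noteq> 0}" by simp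
    have "m \<in> {k. k \<le> d \<and> q k \<noteq> 0}" unfolding m_def
      using \<open>q k \<noteq> 0\<close> that by (intro Max_in fin) auto
    then have m: "m \<le> d" "q m \<noteq> 0" by auto
    have m': "k' \<le> m" if "k' \<le> d" "q k' \<noteq> 0" for k' unfolding m_def
      using that by (intro Max_ge fin) auto
    have "3 < m" using m'[of k] that \<open>q k \<noteq> 0\<close> by simp
    have "F m (Z v) = scl (q m) (F m (?N m))" using m m' by (intro FZ) force+
    moreover have "scl (b 0 - b m) (F m (Z v)) = 0" using main[of m] A3 \<open>3 < m\<close> by simp
    ultimately show False
      using m N1[of m] FF.a_eq_iff[of 0 m] \<open>3 < m\<close> by auto
  qed
  have q3: "q 3 \<noteq> 0"
  proof
    assume "q 3 = 0"
    then have "F 3 (Z v) = 0" using FZ[of 3] q_high False by simp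
    then have "scl (b 1 - b 2) (F 3 (A (A (A v)))) = 0" using main[of 3] by simp
    moreover have "F 3 (A (A (A v))) = F 3 (?N 3)"
      using A1[of 3] A2[of 3] v(2)[of 3] by (simp add: numeral_3_eq_3 EE.A_simps FF.E_simps)
    ultimately show False
      using N1[of 3] False FF.a_eq_iff[of 1 2] by auto
  qed
  define s1 where "s1 = a 0 + a 1 + a 2"
  define s2 where "s2 = a 0 * a 1 + a 0 * a 2 + a 1 * a 2"
  have poly: "(\<Sum>k\<le>d. q k * (\<Prod>t<k. x - a t)) =
      q 0 + q 1 * (x - a 0) + q 2 * ((x - a 0) * (x - a 1)) + q 3 * ((x - a 0) * (x - a 1) * (x - a 2))" for x
  proof -
    have "(\<Sum>k\<le>d. q k * (\<Prod>t<k. x - a t)) = (\<Sum>k\<le>3. q k * (\<Prod>t<k. x - a t))"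
      using q_high False by (intro sum.mono_neutral_right) auto
    then show ?thesis by (simp add: numeral_3_eq_3 numeral_2_eq_2)
  qed
  have "(a i)^2 - (1 - q 3) / q 3 * a i * a (i + 1) + (a (i + 1))^2
      - (q 3 * s1 - q 2) / q 3 * (a i + a (i + 1)) - (q 2 * (a 0 + a 1) - q 1 - q 3 * s2) / q 3 = 0"
    if "i < d" for i
  proof -
    define x y where "x = a i" and "y = a (i + 1)"
    have "y - x \<noteq> 0" using EE.a_eq_iff[of "i + 1" i] that by (simp add: x_def y_def)
    moreover have "(y - x) * (q 3 * (x\<^sup>2 + y\<^sup>2) - (1 - q 3) * x * y - (q 3 * s1 - q 2) * (x + y)
        - (q 2 * (a 0 + a 1) - q 1 - q 3 * s2)) = 0"
      using Z(4)[OF that] unfolding poly x_def[symmetric] Suc_eq_plus1 y_def[symmetric] s1_def s2_def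
      by algebra
    ultimately have "q 3 * (x\<^sup>2 + y\<^sup>2) - (1 - q 3) * x * y - (q 3 * s1 - q 2) * (x + y)
        - (q 2 * (a 0 + a 1) - q 1 - q 3 * s2) = 0" by simp
    moreover define w where "w = inverse (q 3)"
    moreover have "q 3 * w = 1" using q3 by (simp add: w_def)
    ultimately have "x\<^sup>2 - (1 - q 3) * w * x * y + y\<^sup>2 - (q 3 * s1 - q 2) * w * (x + y)
        - (q 2 * (a 0 + a 1) - q 1 - q 3 * s2) * w = 0" by algebra
    then show ?thesis by (simp add: x_def y_def w_def divide_inverse)
  qed
  then show ?thesis by blast
qed

text \<open>
  The difference of two consecutive instances of the quadratic relation is \<open>\<theta>\<^sub>i - \<theta>\<^sub>i\<^sub>+\<^sub>2\<close> times the recurrence.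
\<close>

lemma eigenvalue_recurrence:
  obtains \<beta> \<gamma> \<rho> where
    "\<And>i. i < d \<Longrightarrow> (a i)^2 - \<beta> * a i * a (i + 1) + (a (i + 1))^2 - \<gamma> * (a i + a (i + 1)) - \<rho> = 0"
    "\<And>i. i + 2 \<le> d \<Longrightarrow> a i - \<beta> * a (i + 1) + a (i + 2) = \<gamma>"
proof -
  obtain \<beta> \<gamma> \<rho> where
    q: "\<And>i. i < d \<Longrightarrow> (a i)^2 - \<beta> * a i * a (i + 1) + (a (i + 1))^2 - \<gamma> * (a i + a (i + 1)) - \<rho> = 0"
    using eigenvalue_quadratic by blast
  have "a i - \<beta> * a (i + 1) + a (i + 2) = \<gamma>" if "i + 2 \<le> d" for i
  proof -
    define x y z where "x = a i" and "y = a (i + 1)" and "z = a (i + 2)"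
    have "x^2 - \<beta> * x * y + y^2 - \<gamma> * (x + y) - \<rho> = 0" "y^2 - \<beta> * y * z + z^2 - \<gamma> * (y + z) - \<rho> = 0"
      using q[of i] q[of "i + 1"] that by (simp_all add: x_def y_def z_def)
    then have "(x - z) * (x - \<beta> * y + z - \<gamma>) = 0" by algebra
    moreover have "x - z \<noteq> 0" using EE.a_eq_iff[of i "i + 2"] that by (simp add: x_def z_def)
    ultimately show ?thesis by (simp add: x_def y_def z_def)
  qed
  with q show ?thesis by (rule that)
qed

end

section \<open>Invariance of the lowering rule under reversal of the nodes\<close>

text \<open>
  The left side is the coefficient of \<open>q\<close> in \<open>askey_wilson_form_newton\<close> below; it is affine in \<open>\<alpha> l\<close> because
  its increments are \<open>\<kappa>\<close> times those of \<open>\<alpha>\<close>. At \<open>l = 0\<close> the truncated index \<open>l - 1\<close> is harmless, its term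
  being multiplied by \<open>c 0 = 0\<close>.
\<close>

lemma middle_coefficient_affine:
  fixes \<alpha> c :: "nat \<Rightarrow> 'k::field"
  assumes three: "\<And>l. l + 2 \<le> n \<Longrightarrow> \<alpha> l - \<beta> * \<alpha> (l + 1) + \<alpha> (l + 2) = \<gamma>"
    and crec: "\<And>l. l + 2 \<le> n \<Longrightarrow> c l - \<beta> * c (l + 1) + c (l + 2) = \<kappa>"
    and c0: "c 0 = 0"
  shows "l + 2 \<le> n \<Longrightarrow>
    c l * (\<alpha> l + \<alpha> (l - 1) - \<beta> * \<alpha> l - \<gamma>) + c (l + 1) * (\<alpha> (l + 1) + \<alpha> l - \<beta> * \<alpha> l - \<gamma>) =
    \<kappa> * \<alpha> l + (c 1 * (\<alpha> 1 + \<alpha> 0 - \<beta> * \<alpha> 0 - \<gamma>) - \<kappa> * \<alpha> 0)"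
proof (induction l)
  case 0
  then show ?case by (simp add: c0)
next
  case (Suc l)
  have "c l * (\<alpha> l + \<alpha> (l - 1) - \<beta> * \<alpha> l - \<gamma>) = c l * (\<alpha> l - \<alpha> (l + 1))"
  proof (cases l)
    case (Suc k)
    have "\<alpha> k - \<beta> * \<alpha> (k + 1) + \<alpha> (k + 2) = \<gamma>" using three[of k] Suc.prems Suc by simp
    then have "\<alpha> l + \<alpha> (l - 1) - \<beta> * \<alpha> l - \<gamma> = \<alpha> l - \<alpha> (l + 1)"
      using Suc by (auto simp: algebra_simps)
    then show ?thesis by simp
  qed (simp add: c0)
  moreover have "\<alpha> l - \<beta> * \<alpha> (l + 1) + \<alpha> (l + 2) = \<gamma>" using three[of l] Suc.prems by simp
  moreover have "c l - \<beta> * c (l + 1) + c (l + 2) = \<kappa>" using crec[of l] Suc.prems by simp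
  moreover have "c l * (\<alpha> l + \<alpha> (l - 1) - \<beta> * \<alpha> l - \<gamma>) + c (l + 1) * (\<alpha> (l + 1) + \<alpha> l - \<beta> * \<alpha> l - \<gamma>) =
    \<kappa> * \<alpha> l + (c 1 * (\<alpha> 1 + \<alpha> 0 - \<beta> * \<alpha> 0 - \<gamma>) - \<kappa> * \<alpha> 0)"
    using Suc by simp
  moreover define \<nu> where "\<nu> = c 1 * (\<alpha> 1 + \<alpha> 0 - \<beta> * \<alpha> 0 - \<gamma>) - \<kappa> * \<alpha> 0"
  ultimately have "c (l + 1) * (\<alpha> (l + 1) + \<alpha> l - \<beta> * \<alpha> (l + 1) - \<gamma>) +
      c (l + 2) * (\<alpha> (l + 2) + \<alpha> (l + 1) - \<beta> * \<alpha> (l + 1) - \<gamma>) = \<kappa> * \<alpha> (l + 1) + \<nu>"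
    by algebra
  then show ?case by (simp add: \<nu>_def)
qed

text \<open>
  The left side of an Askey-Wilson relation between \<open>A\<close> and \<open>P\<close>, quadratic in \<open>A\<close> and linear in \<open>P\<close>.
  Its vanishing at \<open>x\<close> determines \<open>P (A (A x))\<close> from \<open>P x\<close> and \<open>P (A x)\<close>.
\<close>

definition askey_wilson_form ::
  "('k::field, 'v::ab_group_add) scl \<Rightarrow> 'k \<Rightarrow> 'k \<Rightarrow> 'k \<Rightarrow> 'k \<Rightarrow> 'k \<Rightarrow> ('v \<Rightarrow> 'v) \<Rightarrow> ('v \<Rightarrow> 'v) \<Rightarrow> 'v \<Rightarrow> 'v" where
  "askey_wilson_form scl \<beta> \<gamma> \<rho> \<kappa> \<nu> A P x =
     A (A (P x)) - scl \<beta> (A (P (A x))) + P (A (A x)) - scl \<gamma> (A (P x) + P (A x))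
     - scl \<rho> (P x) - scl \<kappa> (A x) - scl \<nu> x"

context vector_space
begin

text \<open>
  Here \<open>p, q, r, s\<close> stand for four consecutive Newton vectors, with \<open>P\<close> already known to act on \<open>q\<close> and
  \<open>r\<close> by lowering with factors \<open>c\<close> and \<open>c'\<close>. The relation then measures exactly the defect of
  \<open>P s = c'' r\<close>, so it can be read in both directions: from lowering to the vanishing of the form, and
  back. The case \<open>c = 0\<close> is the start of the chain, where \<open>p\<close> is arbitrary.
\<close>

lemma askey_wilson_form_newton:
  assumes A: "Vector_Spaces.linear scale scale A" and P: "Vector_Spaces.linear scale scale P"
    and p: "c = 0 \<or> A p = q + scale x p" and q: "A q = r + scale y q" and r: "A r = s + scale z r"
    and Pq: "P q = scale c p" and Pr: "P r = scale c' q"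
    and quad: "c * (x^2 - \<beta> * x * y + y^2 - \<gamma> * (x + y) - \<rho>) = 0"
    and lin: "c * (y + x - \<beta> * y - \<gamma>) + c' * (z + y - \<beta> * y - \<gamma>) = \<kappa> * y + \<nu>"
    and crec: "c - \<beta> * c' + c'' = \<kappa>"
  shows "askey_wilson_form scale \<beta> \<gamma> \<rho> \<kappa> \<nu> A P q = P s - scale c'' r"
proof -
  note As = linear_simps[OF A] and Ps = linear_simps[OF P]
  have cp: "scale c (A p) = scale c (q + scale x p)" using p by auto
  have e1: "A (P q) = scale c q + scale (c * x) p"
    using cp by (simp add: Pq As scale_right_distrib)
  have e2: "A (A (P q)) = scale c r + scale (c * y + c * x) q + scale (c * x * x) p"
  proof -
    have "A (A (P q)) = scale c (A q) + scale x (scale c (A p))"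
      unfolding e1 by (simp add: As mult.commute)
    then show ?thesis unfolding cp by (simp add: q algebra_simps)
  qed
  have e3: "P (A q) = scale c' q + scale (c * y) p"
    by (simp add: q Ps Pq Pr mult.commute)
  have e4: "A (P (A q)) = scale c' r + scale (c' * y + c * y) q + scale (c * x * y) p"
  proof -
    have "A (P (A q)) = scale c' (A q) + scale y (scale c (A p))"
      unfolding e3 by (simp add: As mult.commute)
    then show ?thesis unfolding cp by (simp add: q algebra_simps)
  qed
  have e5: "P (A (A q)) = P s + scale (c' * z + c' * y) q + scale (c * y * y) p"
    by (simp add: q r As Ps Pq Pr algebra_simps)
  have "askey_wilson_form scale \<beta> \<gamma> \<rho> \<kappa> \<nu> A P q - (P s - scale c'' r)
      = scale (c - \<beta> * c' + c'' - \<kappa>) r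
      + scale (c * (y + x - \<beta> * y - \<gamma>) + c' * (z + y - \<beta> * y - \<gamma>) - (\<kappa> * y + \<nu>)) q
      + scale (c * (x^2 - \<beta> * x * y + y^2 - \<gamma> * (x + y) - \<rho>)) p"
    unfolding askey_wilson_form_def e2 e4 e5 unfolding e1 e3 unfolding Pq
    by (simp add: q algebra_simps power2_eq_square)
  then show ?thesis using quad lin crec by simp
qed

lemma newton_span:
  assumes A: "Vector_Spaces.linear scale scale A"
  shows "newton scale A c' l v \<in> span ((\<lambda>k. newton scale A c k v) ` {..l})"
proof (induction l)
  case 0
  then show ?case by (simp add: span_base)
next
  case (Suc l)
  let ?S = "\<lambda>l. span ((\<lambda>k. newton scale A c k v) ` {..l})"
  let ?h = "newton scale A c' l v"
  have mono: "?S l \<subseteq> ?S (Suc l)" by (rule span_mono) auto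
  have "A ?h \<in> ?S (Suc l)"
  proof (rule linear_image_span_subset[OF A _ _ Suc.IH])
    fix x assume "x \<in> (\<lambda>k. newton scale A c k v) ` {..l}"
    then obtain k where k: "k \<le> l" "x = newton scale A c k v" by auto
    have "newton scale A c (Suc k) v + scale (c k) (newton scale A c k v) \<in> ?S (Suc l)"
      using k by (intro span_add span_scale span_base) (auto intro!: imageI simp del: newton.simps)
    then show "A x \<in> ?S (Suc l)" using k by simp
  qed simp
  then show ?case using Suc.IH mono by (auto intro!: span_diff span_scale)
qed

text \<open>
  The key step: a map lowering the Newton vectors of the nodes \<open>\<alpha>\<^sub>0, \<dots>, \<alpha>\<^sub>n\<close> with factors \<open>c\<^sub>l\<close> lowers those
  of the reversed nodes with the same factors. It satisfies an Askey-Wilson relation on the first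
  Newton vectors, hence by linearity on their span, which contains the reversed ones. The
  coefficients of the relation are unchanged under reversal of the nodes: the quadratic relation and
  the recurrence are symmetric, the \<open>c\<^sub>l\<close> are the same, and for \<open>\<nu>\<close> this is the equation labelled
  \<open>\<nu>'\<close>. So the relation shows inductively that the map lowers the reversed vectors too.
\<close>

lemma newton_lowering_reverse:
  fixes \<alpha> :: "nat \<Rightarrow> 'a"
  assumes A: "Vector_Spaces.linear scale scale A" and P: "Vector_Spaces.linear scale scale P"
    and quad: "\<And>l. l < n \<Longrightarrow>
      (\<alpha> l)^2 - \<beta> * \<alpha> l * \<alpha> (l + 1) + (\<alpha> (l + 1))^2 - \<gamma> * (\<alpha> l + \<alpha> (l + 1)) - \<rho> = 0"
    and three: "\<And>l. l + 2 \<le> n \<Longrightarrow> \<alpha> l - \<beta> * \<alpha> (l + 1) + \<alpha> (l + 2) = \<gamma>"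
    and c: "\<And>l. c l = s * (\<Sum>h<l. \<alpha> h - \<alpha> (n - h))"
    and low: "\<And>l. l \<le> n \<Longrightarrow> P (newton scale A \<alpha> l v) = scale (c l) (newton scale A \<alpha> (l - 1) v)"
    and "l \<le> n"
  shows "P (newton scale A (\<lambda>h. \<alpha> (n - h)) l v) =
    scale (c l) (newton scale A (\<lambda>h. \<alpha> (n - h)) (l - 1) v)"
proof -
  define t where "t l = newton scale A \<alpha> l v" for l
  define \<alpha>' where "\<alpha>' h = \<alpha> (n - h)" for h
  define h where "h l = newton scale A \<alpha>' l v" for l
  define \<kappa> where "\<kappa> = c 2 - \<beta> * c 1"
  define \<nu> where "\<nu> = c 1 * (\<alpha> 1 + \<alpha> 0 - \<beta> * \<alpha> 0 - \<gamma>) - \<kappa> * \<alpha> 0"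
  have At: "A (t l) = t (Suc l) + scale (\<alpha> l) (t l)" for l by (simp add: t_def)
  have Ah: "A (h l) = h (Suc l) + scale (\<alpha>' l) (h l)" for l by (simp add: h_def)
  have Pt: "P (t l) = scale (c l) (t (l - 1))" if "l \<le> n" for l using low that by (simp add: t_def)
  have c0: "c 0 = 0" by (simp add: c)
  have c_Suc: "c (Suc l) = c l + s * (\<alpha> l - \<alpha>' l)" for l by (simp add: c \<alpha>'_def algebra_simps)
  have three': "\<alpha>' l - \<beta> * \<alpha>' (l + 1) + \<alpha>' (l + 2) = \<gamma>" if "l + 2 \<le> n" for l
  proof -
    have "n - l = Suc (Suc (n - (l + 2)))" "n - (l + 1) = Suc (n - (l + 2))" using that by simp_all
    then show ?thesis using three[of "n - (l + 2)"] that by (simp add: \<alpha>'_def algebra_simps)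
  qed
  have quad': "(\<alpha>' l)^2 - \<beta> * \<alpha>' l * \<alpha>' (l + 1) + (\<alpha>' (l + 1))^2 - \<gamma> * (\<alpha>' l + \<alpha>' (l + 1)) - \<rho> = 0"
    if "l < n" for l
  proof -
    have "n - l = Suc (n - (l + 1))" using that by simp
    then show ?thesis using quad[of "n - (l + 1)"] that by (simp add: \<alpha>'_def algebra_simps)
  qed
  have crec: "c l - \<beta> * c (l + 1) + c (l + 2) = \<kappa>" if "l + 2 \<le> n" for l
    using that
  proof (induction l)
    case (Suc l)
    have "\<alpha> l - \<beta> * \<alpha> (l + 1) + \<alpha> (l + 2) = \<gamma>" "\<alpha>' l - \<beta> * \<alpha>' (l + 1) + \<alpha>' (l + 2) = \<gamma>"
      "c l - \<beta> * c (l + 1) + c (l + 2) = \<kappa>"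
      using Suc three[of l] three'[of l] by simp_all
    moreover have "c (l + 1) - \<beta> * c (l + 2) + c (l + 3) = (c l - \<beta> * c (l + 1) + c (l + 2))
        + s * ((\<alpha> l - \<beta> * \<alpha> (l + 1) + \<alpha> (l + 2)) - (\<alpha>' l - \<beta> * \<alpha>' (l + 1) + \<alpha>' (l + 2)))"
      by (simp add: numeral_3_eq_3 c_Suc algebra_simps)
    ultimately have "c (l + 1) - \<beta> * c (l + 2) + c (l + 3) = \<kappa>" by simp
    then show ?case by (simp add: numeral_3_eq_3)
  qed (simp add: \<kappa>_def c0 numeral_2_eq_2)
  have c1: "c 1 = s * (\<alpha> 0 - \<alpha>' 0)" using c_Suc[of 0] by (simp add: c0)
  have c2: "c 2 = c 1 + s * (\<alpha> 1 - \<alpha>' 1)" using c_Suc[of 1] by (simp add: numeral_2_eq_2)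
  have \<nu>': "\<nu> = c 1 * (\<alpha>' 1 + \<alpha>' 0 - \<beta> * \<alpha>' 0 - \<gamma>) - \<kappa> * \<alpha>' 0"
    using c1 c2 unfolding \<nu>_def \<kappa>_def by algebra
  let ?T = "askey_wilson_form scale \<beta> \<gamma> \<rho> \<kappa> \<nu> A P"
  have Tt: "?T (t l) = 0" if "l + 2 \<le> n" for l
  proof -
    have "?T (t l) = P (t (Suc (Suc l))) - scale (c (l + 2)) (t (Suc l))"
    proof (rule askey_wilson_form_newton[OF A P, where p = "t (l - 1)" and x = "\<alpha> (l - 1)"])
      show "c l = 0 \<or> A (t (l - 1)) = t l + scale (\<alpha> (l - 1)) (t (l - 1))"
        by (cases l) (simp_all add: At c0)
      show "A (t l) = t (Suc l) + scale (\<alpha> l) (t l)" by (rule At)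
      show "A (t (Suc l)) = t (Suc (Suc l)) + scale (\<alpha> (Suc l)) (t (Suc l))" by (rule At)
      show "P (t l) = scale (c l) (t (l - 1))" using Pt that by simp
      show "P (t (Suc l)) = scale (c (Suc l)) (t l)" using Pt[of "Suc l"] that by simp
      show "c l * ((\<alpha> (l - 1))^2 - \<beta> * \<alpha> (l - 1) * \<alpha> l + (\<alpha> l)^2 - \<gamma> * (\<alpha> (l - 1) + \<alpha> l) - \<rho>) = 0"
        using quad[of "l - 1"] that by (cases l) (simp_all add: c0)
      show "c l * (\<alpha> l + \<alpha> (l - 1) - \<beta> * \<alpha> l - \<gamma>) + c (Suc l) * (\<alpha> (Suc l) + \<alpha> l - \<beta> * \<alpha> l - \<gamma>) =
          \<kappa> * \<alpha> l + \<nu>"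
        using middle_coefficient_affine[of n \<alpha> \<beta> \<gamma> c \<kappa>, OF three crec c0 that] by (simp add: \<nu>_def)
      show "c l - \<beta> * c (Suc l) + c (l + 2) = \<kappa>" using crec[OF that] by simp
    qed
    then show ?thesis using Pt[of "l + 2"] that by simp
  qed
  have lin: "Vector_Spaces.linear scale scale ?T"
    by (rule linear_endoI)
      (simp_all add: askey_wilson_form_def linear_simps[OF A] linear_simps[OF P] algebra_simps)
  have Th: "?T (h l) = 0" if "l + 2 \<le> n" for l
  proof -
    have "?T (h l) \<in> {0}"
    proof (rule linear_image_span_subset[OF lin])
      show "h l \<in> span (t ` {..l})" using newton_span[OF A] by (simp add: h_def t_def[abs_def])
    qed (use that Tt in auto)
    then show ?thesis by simp
  qed
  have t0: "t 0 = h 0" by (simp add: t_def h_def)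
  have t1: "t 1 = A (h 0) - scale (\<alpha> 0) (h 0)" by (simp add: t_def h_def)
  have P0: "P (h 0) = 0" using Pt[of 0] by (simp add: c0 t0)
  have P1: "P (h 1) = scale (c 1) (h 0)" if "1 \<le> n"
  proof -
    have "h 1 = t 1 + scale (\<alpha> 0 - \<alpha>' 0) (h 0)" using Ah[of 0] t1 by (simp add: algebra_simps)
    then show ?thesis using Pt[of 1] that by (simp add: linear_simps[OF P] P0 t0)
  qed
  have step: "P (h (l + 2)) = scale (c (l + 2)) (h (l + 1))"
    if "l + 2 \<le> n" "P (h l) = scale (c l) (h (l - 1))" "P (h (Suc l)) = scale (c (Suc l)) (h l)" for l
  proof -
    have "?T (h l) = P (h (Suc (Suc l))) - scale (c (l + 2)) (h (Suc l))"
    proof (rule askey_wilson_form_newton[OF A P, where p = "h (l - 1)" and x = "\<alpha>' (l - 1)"])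
      show "c l = 0 \<or> A (h (l - 1)) = h l + scale (\<alpha>' (l - 1)) (h (l - 1))"
        by (cases l) (simp_all add: Ah c0)
      show "A (h l) = h (Suc l) + scale (\<alpha>' l) (h l)" by (rule Ah)
      show "A (h (Suc l)) = h (Suc (Suc l)) + scale (\<alpha>' (Suc l)) (h (Suc l))" by (rule Ah)
      show "P (h l) = scale (c l) (h (l - 1))" "P (h (Suc l)) = scale (c (Suc l)) (h l)" by fact+
      show "c l * ((\<alpha>' (l - 1))^2 - \<beta> * \<alpha>' (l - 1) * \<alpha>' l + (\<alpha>' l)^2 - \<gamma> * (\<alpha>' (l - 1) + \<alpha>' l) - \<rho>) = 0"
        using quad'[of "l - 1"] that(1) by (cases l) (simp_all add: c0)
      show "c l * (\<alpha>' l + \<alpha>' (l - 1) - \<beta> * \<alpha>' l - \<gamma>) + c (Suc l) * (\<alpha>' (Suc l) + \<alpha>' l - \<beta> * \<alpha>' l - \<gamma>) =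
          \<kappa> * \<alpha>' l + \<nu>"
        using middle_coefficient_affine[of n \<alpha>' \<beta> \<gamma> c \<kappa>, OF three' crec c0 that(1)] by (simp add: \<nu>')
      show "c l - \<beta> * c (Suc l) + c (l + 2) = \<kappa>" using crec[OF that(1)] by simp
    qed
    then show ?thesis using Th[OF that(1)] by simp
  qed
  have "P (h l) = scale (c l) (h (l - 1))" if "l \<le> n" for l
    using that
  proof (induction l rule: less_induct)
    case (less l)
    consider "l = 0" | "l = 1" | k where "l = k + 2"
      by (metis One_nat_def add_2_eq_Suc' not0_implies_Suc)
    then show ?case
    proof cases
      case 3
      then show ?thesis using step[of k] less.IH[of k] less.IH[of "Suc k"] less.prems by simp
    qed (use P0 P1 less.prems c0 in auto)
  qed
  from this[OF \<open>l \<le> n\<close>] show ?thesis by (simp add: h_def \<alpha>'_def[abs_def])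
qed

end

section \<open>Tridiagonal systems in terms of eigenspaces\<close>

context vector_space begin

lemma poly_endo_altdef:
  assumes "degree p \<le> N"
  shows "poly_endo scale p f v = (\<Sum>k\<le>N. scale (coeff p k) ((f ^^ k) v))"
  unfolding poly_endo_def using assms
  by (intro sum.mono_neutral_left) (auto simp: coeff_eq_0)

lemma poly_endo_shift:
  assumes f: "Vector_Spaces.linear scale scale f"
  shows "poly_endo scale ([:- c, 1:] * p) f v = f (poly_endo scale p f v) - scale c (poly_endo scale p f v)"
proof -
  let ?N = "degree p"
  have "degree ([:- c, 1:] * p) \<le> Suc ?N"
    using degree_mult_le[of "[:- c, 1:]" p] by simp
  then have "poly_endo scale ([:- c, 1:] * p) f v =
      (\<Sum>k\<le>Suc ?N. scale (coeff (pCons 0 p) k) ((f ^^ k) v) - scale (c * coeff p k) ((f ^^ k) v))"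
    by (simp add: poly_endo_altdef scale_left_distrib scale_left_diff_distrib algebra_simps)
  also have "\<dots> = (\<Sum>k\<le>Suc ?N. scale (coeff (pCons 0 p) k) ((f ^^ k) v))
      - scale c (\<Sum>k\<le>Suc ?N. scale (coeff p k) ((f ^^ k) v))"
    by (simp add: sum_subtractf scale_sum_right scale_right_distrib)
  also have "(\<Sum>k\<le>Suc ?N. scale (coeff p k) ((f ^^ k) v)) = poly_endo scale p f v"
    by (rule poly_endo_altdef[symmetric]) simp
  also have "(\<Sum>k\<le>Suc ?N. scale (coeff (pCons 0 p) k) ((f ^^ k) v)) = f (poly_endo scale p f v)"
    unfolding sum.atMost_Suc_shift by (simp add: poly_endo_def linear_simps[OF f])
  finally show ?thesis .
qed

lemma poly_endo_tau:
  assumes f: "Vector_Spaces.linear scale scale f"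
  shows "poly_endo scale (tau \<theta> j (j + l)) f v = newton scale f (\<lambda>t. \<theta> (j + t)) l v"
proof (induction l)
  case 0
  then show ?case by (simp add: tau_def poly_endo_def)
next
  case (Suc l)
  have "tau \<theta> j (j + Suc l) = [:- \<theta> (j + l), 1:] * tau \<theta> j (j + l)"
    by (simp add: tau_def mult.commute del: mult_pCons_left mult_pCons_right)
  then show ?case by (simp only: poly_endo_shift[OF f] Suc.IH newton.simps)
qed

text \<open>
  The index-truncated idempotents of a diagonalizable map form an instance of \<open>spectral\<close>. The identity
  \<open>\<Sum>E\<^sub>i = 1\<close> holds because both sides agree on every eigenspace and these span the space.
\<close>

lemma spectral_of_primitive_idempotents:
  assumes diag: "diagonalizable scale A"
    and E: "bij_betw E {0..d} (primitive_idempotents scale A)"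
    and ran: "bij_betw (\<lambda>i. range (E i)) {0..d} (eigenspaces scale A)"
  shows "spectral scale d A (\<lambda>i. if i \<le> d then E i else (\<lambda>_. 0)) (theta scale A E)"
    and "\<And>i. i \<le> d \<Longrightarrow> \<exists>v. E i v \<noteq> 0"
proof -
  have A: "Vector_Spaces.linear scale scale A" using diag by (simp add: diagonalizable_def)
  have prim: "is_primitive_idempotent scale A (range (E i)) (E i)" if "i \<le> d" for i
  proof -
    have "E i \<in> primitive_idempotents scale A" using E that by (auto simp: bij_betw_def)
    then show ?thesis by (auto simp: primitive_idempotents_def is_primitive_idempotent_def)
  qed
  have lin: "Vector_Spaces.linear scale scale (E i)" if "i \<le> d" for i
    using prim[OF that] by (simp add: is_primitive_idempotent_def)
  have eig: "range (E i) \<in> eigenspaces scale A" if "i \<le> d" for i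
    using ran that by (auto simp: bij_betw_def)
  have EE: "E i (E i v) = E i v" if "i \<le> d" for i v
    using prim[OF that] by (simp add: is_primitive_idempotent_def)
  have EE0: "E i (E j v) = 0" if "i \<le> d" "j \<le> d" "i \<noteq> j" for i j v
  proof -
    have "range (E j) \<noteq> range (E i)"
      using inj_onD[OF bij_betw_imp_inj_on[OF ran], of i j] that by auto
    then show ?thesis using prim[OF that(1)] eig[OF that(2)] by (auto simp: is_primitive_idempotent_def)
  qed
  have th: "range (E i) = eigenspace scale A (theta scale A E i) \<and> (\<exists>v. E i v \<noteq> 0)" if i: "i \<le> d" for i
  proof -
    obtain t w where t: "range (E i) = eigenspace scale A t" "w \<noteq> 0" "A w = scale t w"
      using eig[OF i] by (auto simp: eigenspaces_def)
    have w: "w \<in> range (E i)" using t by (simp add: eigenspace_def)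
    have "theta scale A E i = t"
      unfolding theta_def
    proof (rule the_equality)
      show "\<forall>v\<in>range (E i). A v = scale t v" unfolding t by (simp add: eigenspace_def)
      fix s assume "\<forall>v\<in>range (E i). A v = scale s v"
      then have "scale s w = scale t w" using w t by metis
      then show "s = t" using t by simp
    qed
    moreover obtain u where "w = E i u" using w by blast
    ultimately show ?thesis using t by blast
  qed
  show "\<And>i. i \<le> d \<Longrightarrow> \<exists>v. E i v \<noteq> 0" using th by blast
  let ?E = "\<lambda>i. if i \<le> d then E i else (\<lambda>_. 0)"
  have linE: "Vector_Spaces.linear scale scale (?E i)" for i
    by (auto simp: lin intro!: linear_endoI)
  show "spectral scale d A ?E (theta scale A E)"
  proof (intro spectral.intro spectral_axioms.intro vector_space_axioms A linE)
    show "?E i (?E j v) = (if i = j then ?E i v else 0)" for i j v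
      using EE[of i v] EE0[of i j v] by (auto simp: linear_simps[OF lin])
    show "A (?E i v) = scale (theta scale A E i) (?E i v)" for i v
      using th[of i] by (auto simp: linear_simps[OF A] eigenspace_def)
    show "inj_on (theta scale A E) {..d}"
    proof (rule inj_onI)
      fix i j assume "i \<in> {..d}" "j \<in> {..d}" "theta scale A E i = theta scale A E j"
      then have "range (E i) = range (E j)" using th by simp
      then show "i = j" using inj_onD[OF bij_betw_imp_inj_on[OF ran], of i j] \<open>i \<in> {..d}\<close> \<open>j \<in> {..d}\<close> by auto
    qed
    show "(\<Sum>i\<le>d. ?E i v) = v" for v
    proof -
      let ?L = "\<lambda>v. (\<Sum>i\<le>d. ?E i v) - v"
      have "?L v \<in> {0}"
      proof (rule linear_image_span_subset[where f = ?L])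
        show "Vector_Spaces.linear scale scale ?L"
          by (rule linear_endoI) (simp_all add: linear_simps[OF lin] sum.distrib scale_sum_right algebra_simps
              cong: sum.cong_simp)
        show "v \<in> span (\<Union>(eigenspaces scale A))" using diag by (simp add: diagonalizable_def)
        fix x assume "x \<in> \<Union>(eigenspaces scale A)"
        then have "x \<in> (\<Union>i\<in>{0..d}. range (E i))" using ran by (auto simp: bij_betw_def)
        then obtain k y where k: "k \<le> d" "x = E k y" by auto
        then have "(\<Sum>i\<le>d. ?E i x) = (\<Sum>i\<le>d. if i = k then x else 0)"
          using EE EE0 by (intro sum.cong) auto
        then show "?L x \<in> {0}" using k by simp
      qed simp
      then show ?thesis by simp
    qed
  qed auto
qed

end

lemma (in spectral) sum_range_E:
  assumes "finite I"
  shows "(\<Sum>h\<in>I. range (E h)) = {v. \<forall>h. h \<notin> I \<longrightarrow> E h v = 0}"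
proof (intro subset_antisym subsetI)
  fix v assume "v \<in> (\<Sum>h\<in>I. range (E h))"
  then obtain s where s: "v = sum s I" "\<forall>h\<in>I. s h \<in> range (E h)"
    by (auto simp: set_sum_alt[OF assms])
  have "E h (s k) = 0" if "h \<notin> I" "k \<in> I" for h k
    using s that by (force simp: E_E)
  then show "v \<in> {v. \<forall>h. h \<notin> I \<longrightarrow> E h v = 0}"
    by (auto simp: s(1) E_simps intro!: sum.neutral)
next
  fix v assume v: "v \<in> {v. \<forall>h. h \<notin> I \<longrightarrow> E h v = 0}"
  have "v = (\<Sum>h\<le>d. E h v)" by (simp add: sum_E)
  also have "\<dots> = (\<Sum>h\<in>{..d} \<union> I. E h v)"
    using assms by (intro sum.mono_neutral_left) (auto simp: E_beyond)
  also have "\<dots> = (\<Sum>h\<in>I. E h v)"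
    using assms v by (intro sum.mono_neutral_right) auto
  finally show "v \<in> (\<Sum>h\<in>I. range (E h))"
    by (auto simp: set_sum_alt[OF assms] intro!: exI[of _ "\<lambda>h. E h v"])
qed

lemma (in spectral) tridiagonal_of_standard_ordering:
  assumes ord: "\<And>j. j \<le> d \<Longrightarrow> B ` range (E j) \<subseteq> (\<Sum>k \<in> {k. k \<le> d \<and> j \<le> k + 1 \<and> k \<le> j + 1}. range (E k))"
    and B: "Vector_Spaces.linear scl scl B" and ij: "i + 1 < j \<or> j + 1 < i"
  shows "E i (B (E j v)) = 0"
proof (cases "j \<le> d")
  case True
  have "B (E j v) \<in> {v. \<forall>h. h \<notin> {k. k \<le> d \<and> j \<le> k + 1 \<and> k \<le> j + 1} \<longrightarrow> E h v = 0}"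
    using ord[OF True] by (subst sum_range_E[symmetric]) auto
  then show ?thesis using ij by auto
qed (simp add: E_beyond linear_simps[OF B] E_simps)

lemma tridiagonal_system_of_TD_system:
  assumes "finite_dimensional_vector_space scl Basis" and TD: "TD_system scl d A E As Es"
  shows "tridiagonal_system scl Basis d A (\<lambda>i. if i \<le> d then E i else (\<lambda>_. 0)) (theta scl A E)
    As (\<lambda>i. if i \<le> d then Es i else (\<lambda>_. 0)) (theta scl As Es)"
proof -
  interpret finite_dimensional_vector_space scl Basis by fact
  note defs = TD_system_def TD_pair_def standard_ordering_def
  have A: "Vector_Spaces.linear scl scl A" and As: "Vector_Spaces.linear scl scl As"
    using TD by (auto simp: defs diagonalizable_def)
  have spE: "diagonalizable scl A" "bij_betw E {0..d} (primitive_idempotents scl A)"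
      "bij_betw (\<lambda>i. range (E i)) {0..d} (eigenspaces scl A)"
    and spF: "diagonalizable scl As" "bij_betw Es {0..d} (primitive_idempotents scl As)"
      "bij_betw (\<lambda>i. range (Es i)) {0..d} (eigenspaces scl As)"
    using TD by (auto simp: defs)
  interpret EE: spectral scl d A "\<lambda>i. if i \<le> d then E i else (\<lambda>_. 0)" "theta scl A E"
    by (rule spectral_of_primitive_idempotents[OF spE])
  interpret FF: spectral scl d As "\<lambda>i. if i \<le> d then Es i else (\<lambda>_. 0)" "theta scl As Es"
    by (rule spectral_of_primitive_idempotents[OF spF])
  have sum_eq: "(\<Sum>k \<in> {k. k \<le> d \<and> j \<le> k + 1 \<and> k \<le> j + 1}. range (if k \<le> d then G k else (\<lambda>_. 0))) =
      (\<Sum>k \<in> {k. k \<le> d \<and> j \<le> k + 1 \<and> k \<le> j + 1}. range (G k))" for j and G :: "nat \<Rightarrow> 'b \<Rightarrow> 'b"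
    by (rule sum.cong) auto
  have ordE: "As ` range (E j) \<subseteq> (\<Sum>k \<in> {k. k \<le> d \<and> j \<le> k + 1 \<and> k \<le> j + 1}. range (E k))"
    and ordF: "A ` range (Es j) \<subseteq> (\<Sum>k \<in> {k. k \<le> d \<and> j \<le> k + 1 \<and> k \<le> j + 1}. range (Es k))"
    if "j \<le> d" for j
    using TD that by (auto simp only: defs)
  show ?thesis
  proof (intro tridiagonal_system.intro tridiagonal_system_axioms.intro finite_dimensional_vector_space_axioms
      EE.spectral_axioms FF.spectral_axioms)
    show "(if i \<le> d then E i else (\<lambda>_. 0)) (As ((if j \<le> d then E j else (\<lambda>_. 0)) v)) = 0"
      if "i + 1 < j \<or> j + 1 < i" for i j v
      by (rule EE.tridiagonal_of_standard_ordering[OF _ As that]) (unfold sum_eq, use ordE in simp)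
    show "(if i \<le> d then Es i else (\<lambda>_. 0)) (A ((if j \<le> d then Es j else (\<lambda>_. 0)) v)) = 0"
      if "i + 1 < j \<or> j + 1 < i" for i j v
      by (rule FF.tridiagonal_of_standard_ordering[OF _ A that]) (unfold sum_eq, use ordF in simp)
    show "S = {0} \<or> S = UNIV" if "subspace S" "A ` S \<subseteq> S" "As ` S \<subseteq> S" for S
      using TD that by (auto simp: TD_system_def TD_pair_def)
    show "\<exists>v. (if i \<le> d then E i else (\<lambda>_. 0)) v \<noteq> 0" if "i \<le> d" for i
      using spectral_of_primitive_idempotents(2)[OF spE] that by simp
    show "\<exists>v. (if i \<le> d then Es i else (\<lambda>_. 0)) v \<noteq> 0" if "i \<le> d" for i
      using spectral_of_primitive_idempotents(2)[OF spF] that by simp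
  qed
qed

lemma sum_ranges_eq:
  assumes "spectral scl d A (\<lambda>i. if i \<le> d then E i else (\<lambda>_. 0)) a" "I \<subseteq> {..d}"
  shows "(\<Sum>h\<in>I. range (E h)) = {v. \<forall>h. h \<notin> I \<and> h \<le> d \<longrightarrow> E h v = 0}"
proof -
  interpret EE: spectral scl d A "\<lambda>i. if i \<le> d then E i else (\<lambda>_. 0)" a by fact
  have "(\<Sum>h\<in>I. range (E h)) = (\<Sum>h\<in>I. range (if h \<le> d then E h else (\<lambda>_. 0)))"
    using assms(2) by (intro sum.cong) auto
  also have "\<dots> = {v. \<forall>h. h \<notin> I \<longrightarrow> (if h \<le> d then E h else (\<lambda>_. 0)) v = 0}"
    using assms(2) finite_subset by (intro EE.sum_range_E) auto
  finally show ?thesis by auto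
qed

lemma U_Down_K_sub_eq:
  assumes "spectral scl d A (\<lambda>i. if i \<le> d then E i else (\<lambda>_. 0)) a"
    and "spectral scl d B (\<lambda>i. if i \<le> d then Es i else (\<lambda>_. 0)) b"
    and "i \<le> d"
  shows "U_Down d E Es i = {v. (\<forall>h. i < h \<and> h \<le> d \<longrightarrow> Es h v = 0) \<and>
      (\<forall>h. d - i < h \<and> h \<le> d \<longrightarrow> E h v = 0)}"
    and "K_sub d E Es i = {v. (\<forall>h. i < h \<and> h \<le> d \<longrightarrow> Es h v = 0) \<and>
      (\<forall>h. (h < i \<or> d - i < h) \<and> h \<le> d \<longrightarrow> E h v = 0)}"
proof -
  have sub: "{0..i} \<subseteq> {..d}" "{0..d - i} \<subseteq> {..d}" "{i..d - i} \<subseteq> {..d}" using assms(3) by auto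
  note sums = sum_ranges_eq[OF assms(2) sub(1)] sum_ranges_eq[OF assms(1) sub(2)]
    sum_ranges_eq[OF assms(1) sub(3)]
  show "U_Down d E Es i = {v. (\<forall>h. i < h \<and> h \<le> d \<longrightarrow> Es h v = 0) \<and>
      (\<forall>h. d - i < h \<and> h \<le> d \<longrightarrow> E h v = 0)}"
    unfolding U_Down_def sums by auto
  show "K_sub d E Es i = {v. (\<forall>h. i < h \<and> h \<le> d \<longrightarrow> Es h v = 0) \<and>
      (\<forall>h. (h < i \<or> d - i < h) \<and> h \<le> d \<longrightarrow> E h v = 0)}"
    unfolding K_sub_def sums by auto
qed

theorem corollary15p3:
  fixes scl :: "'k::field \<Rightarrow> 'v::ab_group_add \<Rightarrow> 'v"
    and Basis :: "'v set"
    and d :: nat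
    and A As \<Psi> :: "'v \<Rightarrow> 'v"
    and E Es :: "nat \<Rightarrow> 'v \<Rightarrow> 'v"
  assumes "finite_dimensional_vector_space scl Basis"
    and "vector_space.dim scl (UNIV :: 'v set) > 0"
    and "d \<ge> 1"
    and "TD_system scl d A E As Es"
    and "is_Psi scl d A E Es \<Psi>"
  shows "(\<forall>i. 1 \<le> i \<and> i \<le> d \<longrightarrow> \<Psi> ` U_Down d E Es i \<subseteq> U_Down d E Es (i - 1)) \<and>
         \<Psi> ` U_Down d E Es 0 = {0}"
proof -
  define \<theta> where "\<theta> = theta scl A E"
  define E' where "E' = (\<lambda>i. if i \<le> d then E i else (\<lambda>_. 0))"
  define F' where "F' = (\<lambda>i. if i \<le> d then Es i else (\<lambda>_. 0))"
  interpret T: tridiagonal_system scl Basis d A E' \<theta> As F' "theta scl As Es"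
    unfolding E'_def F'_def \<theta>_def by (rule tridiagonal_system_of_TD_system) fact+
  \<comment> \<open>In the system with \<open>E\<close> reversed, the split components are the \<open>U\<^sub>i\<^sup>\<Down>\<close> and the \<open>K\<^sub>j\<close> are the same.\<close>
  interpret R: tridiagonal_system scl Basis d A "\<lambda>i. if i \<le> d then E' (d - i) else (\<lambda>_. 0)" "\<lambda>i. \<theta> (d - i)"
      As F' "theta scl As Es"
    by (rule T.reverse_E)
  have P: "Vector_Spaces.linear scl scl \<Psi>" using assms(5) by (simp add: is_Psi_def)
  have Psi: "\<Psi> (poly_endo scl (tau \<theta> i j) A v) =
      scl (vartheta d \<theta> j - vartheta d \<theta> i) (poly_endo scl (tau \<theta> i (j - 1)) A v)"
    if "2 * i \<le> d" "i \<le> j" "j \<le> d - i" "v \<in> K_sub d E Es i" for i j v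
    using assms(5) that by (simp add: is_Psi_def \<theta>_def Let_def)
  note U_eq = U_Down_K_sub_eq[OF T.EE.spectral_axioms[unfolded E'_def] T.FF.spectral_axioms[unfolded F'_def]]
  have U: "U_Down d E Es i = R.flag_meet i i" if "i \<le> d" for i
  proof -
    have "(\<forall>h. d - i < h \<and> h \<le> d \<longrightarrow> E h v = 0) \<longleftrightarrow> (\<forall>h<i. E (d - h) v = 0)" for v
    proof safe
      fix h assume "\<forall>h<i. E (d - h) v = 0" "d - i < h" "h \<le> d"
      then show "E h v = 0" using that by (auto dest: spec[of _ "d - h"])
    qed (use that in auto)
    then show ?thesis using that unfolding U_eq(1)[OF that] R.flag_meet_def by (auto simp: E'_def F'_def)
  qed
  have K: "R.K_space j = K_sub d E Es j" if "2 * j \<le> d" for j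
  proof -
    have "(\<forall>h. h < j \<or> d - j < h \<longrightarrow> (if h \<le> d then E' (d - h) else (\<lambda>_. 0)) v = 0) \<longleftrightarrow>
        (\<forall>h. (h < j \<or> d - j < h) \<and> h \<le> d \<longrightarrow> E h v = 0)" for v
    proof (intro iffI allI impI)
      fix h assume "\<forall>h. h < j \<or> d - j < h \<longrightarrow> (if h \<le> d then E' (d - h) else (\<lambda>_. 0)) v = 0"
        "(h < j \<or> d - j < h) \<and> h \<le> d"
      then show "E h v = 0" using that by (auto simp: E'_def dest: spec[of _ "d - h"])
    next
      fix h assume "\<forall>h. (h < j \<or> d - j < h) \<and> h \<le> d \<longrightarrow> E h v = 0" "h < j \<or> d - j < h"
      moreover from this(2) have "d - h < j \<or> d - j < d - h" if "h \<le> d"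
        using \<open>2 * j \<le> d\<close> that by linarith
      ultimately show "(if h \<le> d then E' (d - h) else (\<lambda>_. 0)) v = 0"
        by (auto simp: E'_def)
    qed
    moreover have "j \<le> d" using that by simp
    ultimately show ?thesis unfolding U_eq(2)[OF \<open>j \<le> d\<close>] R.K_space_def by (auto simp: F'_def)
  qed
  obtain \<beta> \<gamma> \<rho> where
    quad: "\<And>i. i < d \<Longrightarrow>
      (\<theta> i)^2 - \<beta> * \<theta> i * \<theta> (i + 1) + (\<theta> (i + 1))^2 - \<gamma> * (\<theta> i + \<theta> (i + 1)) - \<rho> = 0"
    and three: "\<And>i. i + 2 \<le> d \<Longrightarrow> \<theta> i - \<beta> * \<theta> (i + 1) + \<theta> (i + 2) = \<gamma>"
    by (rule T.eigenvalue_recurrence) (rule that)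
  \<comment> \<open>The reversal principle on the eigenvalues \<open>\<theta>\<^sub>j, \<dots>, \<theta>\<^sub>d\<^sub>-\<^sub>j\<close>, of which there are \<open>d - 2 j + 1\<close>.\<close>
  have lower: "\<exists>c. \<Psi> (newton scl A (\<lambda>t. \<theta> (d - (j + t))) l v) =
      scl c (newton scl A (\<lambda>t. \<theta> (d - (j + t))) (l - 1) v) \<and> (l = 0 \<longrightarrow> c = 0)"
    if j: "2 * j \<le> d" and l: "l \<le> d - 2 * j" and v: "v \<in> K_sub d E Es j" for j l v
  proof -
    define n where "n = d - 2 * j"
    define \<alpha> where "\<alpha> t = \<theta> (j + t)" for t
    define s where "s = inverse (\<theta> 0 - \<theta> d)"
    define c where "c l = s * (\<Sum>h<l. \<alpha> h - \<alpha> (n - h))" for l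
    have rev: "\<alpha> (n - h) = \<theta> (d - (j + h))" if "h \<le> n" for h
    proof -
      have "j + (n - h) = d - (j + h)" using that j unfolding n_def by arith
      then show ?thesis by (simp add: \<alpha>_def)
    qed
    have low: "\<Psi> (newton scl A \<alpha> l v) = scl (c l) (newton scl A \<alpha> (l - 1) v)" if "l \<le> n" for l
    proof -
      have "vartheta d \<theta> (j + l) - vartheta d \<theta> j = c l"
      proof -
        have "vartheta d \<theta> (j + l) - vartheta d \<theta> j =
            (\<Sum>h\<in>{j..<j + l}. (\<theta> h - \<theta> (d - h)) / (\<theta> 0 - \<theta> d))"
          using sum_diff_nat_ivl[of 0 j "j + l" "\<lambda>h. (\<theta> h - \<theta> (d - h)) / (\<theta> 0 - \<theta> d)"]
          by (simp add: vartheta_def)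
        also have "\<dots> = (\<Sum>h<l. (\<theta> (j + h) - \<theta> (d - (j + h))) / (\<theta> 0 - \<theta> d))"
          by (rule sum.reindex_bij_witness[where i = "\<lambda>h. j + h" and j = "\<lambda>h. h - j"]) auto
        also have "\<dots> = c l"
          unfolding c_def sum_distrib_left s_def
          by (rule sum.cong) (use that rev in \<open>auto simp: \<alpha>_def divide_inverse\<close>)
        finally show ?thesis .
      qed
      moreover have "j + l \<le> d - j" using that j by (simp add: n_def)
      ultimately have *: "\<Psi> (newton scl A \<alpha> l v) = scl (c l) (poly_endo scl (tau \<theta> j (j + l - 1)) A v)"
        using Psi[OF j, of "j + l" v] v T.poly_endo_tau[OF T.EE.linear_A, of \<theta> j l v]
        by (simp add: \<alpha>_def[abs_def])
      show ?thesis
      proof (cases l)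
        case 0
        then show ?thesis using * by (simp add: c_def)
      next
        case (Suc k)
        then show ?thesis using * T.poly_endo_tau[OF T.EE.linear_A, of \<theta> j k v]
          by (simp add: \<alpha>_def[abs_def])
      qed
    qed
    have "\<Psi> (newton scl A (\<lambda>h. \<alpha> (n - h)) l v) = scl (c l) (newton scl A (\<lambda>h. \<alpha> (n - h)) (l - 1) v)"
    proof (rule T.newton_lowering_reverse[OF T.EE.linear_A P _ _ c_def low])
      show "(\<alpha> l)^2 - \<beta> * \<alpha> l * \<alpha> (l + 1) + (\<alpha> (l + 1))^2 - \<gamma> * (\<alpha> l + \<alpha> (l + 1)) - \<rho> = 0"
        if "l < n" for l
        using quad[of "j + l"] that by (simp add: \<alpha>_def n_def)
      show "\<alpha> l - \<beta> * \<alpha> (l + 1) + \<alpha> (l + 2) = \<gamma>" if "l + 2 \<le> n" for l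
        using three[of "j + l"] that by (simp add: \<alpha>_def n_def)
    qed (use l in \<open>simp_all add: n_def\<close>)
    moreover have "newton scl A (\<lambda>h. \<alpha> (n - h)) k v = newton scl A (\<lambda>t. \<theta> (d - (j + t))) k v"
      if "k \<le> n" for k
      by (rule newton_cong) (use rev that in auto)
    ultimately have "\<Psi> (newton scl A (\<lambda>t. \<theta> (d - (j + t))) l v) =
        scl (c l) (newton scl A (\<lambda>t. \<theta> (d - (j + t))) (l - 1) v)"
      using l by (simp add: n_def)
    then show ?thesis by (intro exI[of _ "c l"]) (simp add: c_def)
  qed
  \<comment> \<open>It suffices to treat the translates of the \<open>K\<^sub>j\<close>, which span \<open>U\<^sub>i\<^sup>\<Down>\<close>.\<close>
  have gen: "\<Psi> y \<in> (if i = 0 then {0} else R.flag_meet (i - 1) (i - 1))" if y: "y \<in> R.K_translates i" and i: "i \<le> d" for i y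
  proof -
    obtain j v where j: "j \<le> i" "j \<le> d - i" "v \<in> R.K_space j"
      "y = newton scl A (\<lambda>t. \<theta> (d - (j + t))) (i - j) v"
      using y unfolding R.K_translates_def by blast
    have j2: "2 * j \<le> d" using j i by linarith
    have "i - j \<le> d - 2 * j" using j i by linarith
    from lower[OF j2 this, of v] obtain c where
      c: "\<Psi> y = scl c (newton scl A (\<lambda>t. \<theta> (d - (j + t))) (i - j - 1) v)" "i - j = 0 \<longrightarrow> c = 0"
      using j K[OF j2] by auto
    show ?thesis
    proof (cases "i - j = 0")
      case True
      then show ?thesis using c T.subspace_0[OF R.subspace_flag_meet] by simp
    next
      case False
      have "v \<in> R.flag_meet j j" using j(3) by (auto simp: R.K_space_def R.flag_meet_def)
      then have "newton scl A (\<lambda>t. \<theta> (d - (j + t))) (i - j - 1) v \<in> R.flag_meet (i - 1) (i - 1)"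
        using R.newton_flag_meet[of v j j "i - j - 1"] False by simp
      then show ?thesis using c False T.subspace_scale[OF R.subspace_flag_meet] by auto
    qed
  qed
  have main: "\<Psi> x \<in> (if i = 0 then {0} else R.flag_meet (i - 1) (i - 1))" if "x \<in> U_Down d E Es i" "i \<le> d" for i x
  proof (rule T.linear_image_span_subset[OF P])
    show "x \<in> T.span (R.K_translates i)" using R.flag_meet_span[OF that(2)] that U by simp
    show "T.subspace (if i = 0 then {0} else R.flag_meet (i - 1) (i - 1))"
      by (simp add: R.subspace_flag_meet)
  qed (rule gen, use that in auto)
  show ?thesis
  proof (intro conjI allI impI)
    fix i assume "1 \<le> i \<and> i \<le> d"
    then show "\<Psi> ` U_Down d E Es i \<subseteq> U_Down d E Es (i - 1)"
      using main[of _ i] U[of "i - 1"] by auto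
  next
    have "0 \<in> U_Down d E Es 0" using U[of 0] T.subspace_0[OF R.subspace_flag_meet] by simp
    moreover have "\<Psi> 0 = 0" by (rule T.linear_simps(4)[OF P])
    ultimately show "\<Psi> ` U_Down d E Es 0 = {0}" using main[of _ 0] by force
  qed
qed

end
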